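(* There exists a universal constant $c>0$ such that the following holds. Let $n,k$ be nonnegative integers, $r\ge 1$, $\epsilon\in(0,1)$, and let $A,B\subseteq\mathbb{F}_2^n$ with $|A|=|B|=2^k$ and $|A+B|\le r|A|$, where $A+B=\{a+b:a\in A,b\in B\}$. Let $\mathbf{A},\mathbf{B}$ be independent and uniformly distributed over $A$ and $B$ respectively. Then the distribution of $\mathbf{A}+\mathbf{B}$ is $\epsilon$-close (in statistical distance) to a convex combination of affine sources, each of entropy at least $k-c\,\epsilon^{-2}\log(r)\log^3(r/\epsilon)$.
   Context: Logarithms are base $2$. An affine source of entropy $k'$ is the uniform distribution over an affine subspace of $\mathbb{F}_2^n$ of dimension $k'$ (so its min-entropy is $k'$). Two distributions are $\epsilon$-close if their statistical (total variation) distance is at most $\epsilon$. *)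

theory Defs
  imports
    "HOL-Probability.Probability"
    "HOL-Library.Z2"
    "HOL-Library.Function_Algebras"
begin

text \<open>
  The dimension \<^term>\<open>n\<close> is quantified inside the statement (the constant is uniform in it),
  so it cannot be a type parameter. The vectors of the \<^term>\<open>n\<close>-dimensional space over the
  two-element field are the functions \<^typ>\<open>nat \<Rightarrow> bit\<close> vanishing outside \<^term>\<open>{..<n}\<close>, with
  pointwise addition.
\<close>

definition F2 :: "nat \<Rightarrow> (nat \<Rightarrow> bit) set" where
  "F2 n = {x. \<forall>i\<ge>n. x i = 0}"

definition f2_scale :: "bit \<Rightarrow> (nat \<Rightarrow> bit) \<Rightarrow> nat \<Rightarrow> bit" where
  "f2_scale c x = (\<lambda>i. c * x i)"

interpretation f2: vector_space f2_scale
  by unfold_locales (auto simp: f2_scale_def fun_eq_iff algebra_simps)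

lemma subspace_F2: "f2.subspace (F2 n)"
  by (auto simp: f2.subspace_def F2_def f2_scale_def)

definition affine_subspace :: "nat \<Rightarrow> nat \<Rightarrow> (nat \<Rightarrow> bit) set \<Rightarrow> bool" where
  "affine_subspace n d S \<longleftrightarrow>
     (\<exists>a V. a \<in> F2 n \<and> V \<subseteq> F2 n \<and> f2.subspace V \<and> f2.dim V = d \<and> S = (\<lambda>v. a + v) ` V)"

definition affine_source :: "nat \<Rightarrow> nat \<Rightarrow> (nat \<Rightarrow> bit) pmf \<Rightarrow> bool" where
  "affine_source n d D \<longleftrightarrow> (\<exists>S. affine_subspace n d S \<and> D = pmf_of_set S)"

definition stat_dist :: "'a pmf \<Rightarrow> 'a pmf \<Rightarrow> real" where
  "stat_dist P Q = (SUP E. \<bar>measure_pmf.prob P E - measure_pmf.prob Q E\<bar>)"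

text \<open>
  The mixing weights form a distribution \<^term>\<open>M\<close> on sources; \<^term>\<open>join_pmf M\<close> gives \<^term>\<open>x\<close>
  the mass obtained by averaging \<^term>\<open>pmf D x\<close> over \<^term>\<open>M\<close>. Since there are only finitely
  many affine sources for each \<^term>\<open>n\<close>, such a mixture of them is a finite convex combination.
\<close>

definition convex_combination_of :: "('a pmf \<Rightarrow> bool) \<Rightarrow> 'a pmf \<Rightarrow> bool" where
  "convex_combination_of P Q \<longleftrightarrow> (\<exists>M. (\<forall>D\<in>set_pmf M. P D) \<and> Q = join_pmf M)"

text \<open>
  \<^const>\<open>pair_pmf\<close> is the joint law of independent variables. The sets must be finite and
  nonempty for \<^const>\<open>pmf_of_set\<close> to be meaningful.
\<close>

definition sum_distribution :: "(nat \<Rightarrow> bit) set \<Rightarrow> (nat \<Rightarrow> bit) set \<Rightarrow> (nat \<Rightarrow> bit) pmf" where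
  "sum_distribution A B = map_pmf (\<lambda>(a, b). a + b) (pair_pmf (pmf_of_set A) (pmf_of_set B))"

end

theory Submission
  imports Defs "HOL-Library.Set_Algebras"
begin

text \<open>
  By a minimax argument it suffices to find, for every test function \<open>f\<close> with values in \<open>[0, 1]\<close>,
  one affine source of large dimension on which the mean of \<open>f\<close> is at least its mean under the
  sum of the two sources, minus \<open>\<epsilon>/2\<close>. If \<open>r < 3/2\<close>, then \<open>A\<close> is a coset. Otherwise
  Petridis' inequality bounds the sixfold sum of \<open>D = A + B\<close> by \<open>r\<^sup>1\<^sup>3 |A|\<close>; factoring out a maximal
  subspace \<open>W\<close> that meets this set only in \<open>0\<close> makes \<open>A\<close> and \<open>B\<close> dense while \<open>D\<close> is still embedded.
  In the dense setting, Croot--Sisask sampling gives a set \<open>X\<close> of size at least \<open>|B| / (2 r\<^sup>q)\<close>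
  whose elements are almost periods of the convolution; iterating \<open>l\<close> times and using Chang's
  bound on the large spectrum of \<open>X\<close> turns these into a subspace \<open>V\<close> of almost periods.
  Running the argument for \<open>f + 1\<close> on \<open>D\<close>, and \<open>0\<close> elsewhere, forces more than half of the
  resulting coset of \<open>V\<close> to lie in \<open>D\<close> modulo \<open>W\<close>, so that the coset can be lifted back.
\<close>

subsection \<open>Vectors and subspaces over the two-element field\<close>

text \<open>The loss must vanish with \<open>log 2 r\<close>, while sampling and the spectral bound
  always cost an additive constant. Such a constant is absorbed only when \<open>log 2 r\<close> is
  bounded below, hence the exact treatment of doubling below 3/2. Otherwise the shape of the loss
  comes from three choices: \<open>l\<close> is of order log(r/\<epsilon>), the accuracy
  \<open>e\<close> is of order \<epsilon>/l because errors add up over the iterations, and the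
  sample size \<open>q\<close> is of order log(r/\<epsilon>)/e^2. The almost periods lose a factor
  \<open>r ^ q\<close>, so the codimension is of order q log r.

  The obstacle in the dense model is the way back: the lift has to choose representatives lying in
  \<open>D\<close>, because only there does the model function record \<open>f\<close>. The lifted
  subspace is sought inside \<open>D + D\<close>; its closure under addition compares the sum of two
  elements with a third, which involves three elements of \<open>D + D\<close> and explains the
  sixfold sum. No quotient space is formed: the model consists of \<open>A + W\<close>,
  \<open>B + W\<close> and a \<open>W\<close>-periodic function in the original space.\<close>

lemma f2_add_self [simp]: "x + x = (0 :: nat \<Rightarrow> bit)"
  by (rule ext) simp

lemma f2_add_cancel [simp]: "x + (x + y) = (y :: nat \<Rightarrow> bit)"
  by (simp add: add.assoc [symmetric])

lemma f2_add_eq_0_iff: "x + y = 0 \<longleftrightarrow> x = (y :: nat \<Rightarrow> bit)"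
  by (metis add.right_neutral f2_add_cancel f2_add_self)

lemma f2_scale_0 [simp]: "f2_scale 0 x = 0"
  and f2_scale_1 [simp]: "f2_scale 1 x = x"
  by (auto simp: f2_scale_def)

lemma f2_subspaceI:
  assumes "0 \<in> V" "\<And>x y. x \<in> V \<Longrightarrow> y \<in> V \<Longrightarrow> x + y \<in> V"
  shows "f2.subspace V"
proof -
  have "f2_scale c x \<in> V" if "x \<in> V" for c x
    using that assms(1) by (cases c) simp_all
  then show ?thesis using assms by (auto simp: f2.subspace_def)
qed

lemma finite_F2 [simp]: "finite (F2 n)"
proof -
  have "F2 n = {f. \<forall>i. (i \<in> {..<n} \<longrightarrow> f i \<in> UNIV) \<and> (i \<notin> {..<n} \<longrightarrow> f i = 0)}"
    by (auto simp: F2_def)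
  moreover have "finite (UNIV :: bit set)"
    by (rule finite_subset [of _ "{0, 1}"]) (auto intro: bit.exhaust)
  ultimately show ?thesis
    using finite_set_of_finite_funs [of "{..<n}" "UNIV :: bit set" 0] by simp
qed

lemma zero_in_F2 [simp]: "0 \<in> F2 n"
  by (simp add: F2_def)

lemma F2_add [simp]: "x \<in> F2 n \<Longrightarrow> y \<in> F2 n \<Longrightarrow> x + y \<in> F2 n"
  by (simp add: F2_def)

lemma card_F2_pos [simp]: "card (F2 n) > 0"
  using finite_F2 zero_in_F2 by (metis card_gt_0_iff empty_iff)

lemma sum_F2_shift:
  assumes "s \<in> F2 n"
  shows "(\<Sum>x\<in>F2 n. f (s + x)) = (\<Sum>x\<in>F2 n. f x)"
  by (rule sum.reindex_bij_witness [of _ "(+) s" "(+) s"]) (use assms in auto)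

text \<open>A vector outside the span doubles it, since the translate by that vector is disjoint
  from the old span.\<close>

lemma card_span_independent:
  assumes "finite S" "f2.independent S"
  shows "finite (f2.span S) \<and> card (f2.span S) = 2 ^ card S"
  using assms
proof (induction S rule: finite_induct)
  case empty
  then show ?case by simp
next
  case (insert b S)
  have ind: "f2.independent S" and b: "b \<notin> f2.span S"
    using insert by (auto simp: f2.independent_insert)
  have IH: "finite (f2.span S)" "card (f2.span S) = 2 ^ card S"
    using insert.IH ind by auto
  have eq: "f2.span (insert b S) = f2.span S \<union> (+) b ` f2.span S"
  proof (intro equalityI subsetI)
    fix x assume "x \<in> f2.span (insert b S)"
    then obtain k where k: "x - f2_scale k b \<in> f2.span S"
      using f2.span_breakdown_eq by blast
    show "x \<in> f2.span S \<union> (+) b ` f2.span S"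
    proof (cases k)
      case zero
      then show ?thesis using k by simp
    next
      case one
      then have "x - b \<in> f2.span S" using k by simp
      moreover have "x = b + (x - b)" by simp
      ultimately show ?thesis by blast
    qed
  next
    fix x assume "x \<in> f2.span S \<union> (+) b ` f2.span S"
    then show "x \<in> f2.span (insert b S)"
      using f2.span_mono [of S "insert b S"]
      by (auto intro!: f2.span_add f2.span_base [of b])
  qed
  have disj: "f2.span S \<inter> (+) b ` f2.span S = {}"
  proof (rule ccontr)
    assume "f2.span S \<inter> (+) b ` f2.span S \<noteq> {}"
    then obtain y where "y \<in> f2.span S" "b + y \<in> f2.span S" by auto
    then have "(b + y) - y \<in> f2.span S" using f2.span_diff by blast
    then show False using b by simp
  qed
  have "card (f2.span (insert b S)) = card (f2.span S) + card ((+) b ` f2.span S)"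
    unfolding eq using IH disj by (intro card_Un_disjoint) auto
  also have "card ((+) b ` f2.span S) = card (f2.span S)"
    by (intro card_image) auto
  finally have "card (f2.span (insert b S)) = 2 ^ card (insert b S)"
    using IH insert by simp
  moreover have "finite (f2.span (insert b S))" unfolding eq using IH by simp
  ultimately show ?case by simp
qed

lemma card_subspace_eq_power_dim:
  assumes "f2.subspace V" "finite V"
  shows "card V = 2 ^ f2.dim V"
proof -
  obtain S where S: "S \<subseteq> V" "f2.independent S" "V \<subseteq> f2.span S" "card S = f2.dim V"
    using f2.basis_exists by blast
  have "f2.span S = V"
    using S assms f2.span_minimal by blast
  moreover have "finite S" using S assms finite_subset by blast
  ultimately show ?thesis using card_span_independent [of S] S by simp
qed

subsection \<open>Characters\<close>

text \<open>The character (-1)^<x,y>, written as a product of real signs over the coordinates; it is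
  symmetric in its two arguments.\<close>

definition chi :: "nat \<Rightarrow> (nat \<Rightarrow> bit) \<Rightarrow> (nat \<Rightarrow> bit) \<Rightarrow> real" where
  "chi n y x = (\<Prod>i<n. if x i = 1 \<and> y i = 1 then - 1 else 1)"

lemma chi_commute: "chi n y x = chi n x y"
  unfolding chi_def by (intro prod.cong) auto

lemma chi_0 [simp]: "chi n y 0 = 1" "chi n 0 x = 1"
  by (auto simp: chi_def)

lemma chi_add: "chi n y (x + x') = chi n y x * chi n y x'"
proof -
  have "(if (x + x') i = 1 \<and> y i = 1 then - 1 else 1 :: real) =
     (if x i = 1 \<and> y i = 1 then - 1 else 1) * (if x' i = 1 \<and> y i = 1 then - 1 else 1)" for i
    by (cases "x i"; cases "x' i") auto
  then show ?thesis unfolding chi_def by (simp add: prod.distrib [symmetric])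
qed

lemma chi_add_left: "chi n (y + y') x = chi n y x * chi n y' x"
  by (metis chi_add chi_commute)

lemma abs_chi [simp]: "\<bar>chi n y x\<bar> = 1"
proof -
  have "chi n y x * chi n y x = 1" by (simp add: chi_add [symmetric])
  then have "chi n y x = 1 \<or> chi n y x = - 1" by (simp add: square_eq_1_iff)
  then show ?thesis by auto
qed

lemma chi_cases: "chi n y x = 1 \<or> chi n y x = - 1"
  using abs_chi [of n y x] by linarith

lemma sum_chi:
  assumes "y \<in> F2 n"
  shows "(\<Sum>x\<in>F2 n. chi n y x) = (if y = 0 then real (card (F2 n)) else 0)"
proof (cases "y = 0")
  case False
  then obtain i where i: "y i \<noteq> 0" by (auto simp: fun_eq_iff)
  then have "i < n" using assms unfolding F2_def by (metis (mono_tags) mem_Collect_eq not_less)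
  \<comment> \<open>A coordinate vector on which the character is -1; translating by it negates the
    whole sum.\<close>
  define e :: "nat \<Rightarrow> bit" where "e = (\<lambda>j. if j = i then 1 else 0)"
  have "e \<in> F2 n" using \<open>i < n\<close> by (auto simp: F2_def e_def)
  have "chi n y e = (\<Prod>j<n. if j = i then - 1 else 1)"
    unfolding chi_def using i by (intro prod.cong) (auto simp: e_def)
  also have "\<dots> = - 1" using \<open>i < n\<close> by (simp add: prod.delta)
  finally have "chi n y e = - 1" .
  have "(\<Sum>x\<in>F2 n. chi n y x) = (\<Sum>x\<in>F2 n. chi n y (e + x))"
    by (rule sum_F2_shift [OF \<open>e \<in> F2 n\<close>, symmetric])
  also have "\<dots> = - (\<Sum>x\<in>F2 n. chi n y x)"
    by (simp add: chi_add \<open>chi n y e = - 1\<close> sum_negf)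
  finally show ?thesis using False by simp
qed simp

lemma sum_chi_left:
  assumes "x \<in> F2 n"
  shows "(\<Sum>y\<in>F2 n. chi n y x) = (if x = 0 then real (card (F2 n)) else 0)"
  using sum_chi [OF assms] by (simp add: chi_commute [of n _ x])

section \<open>Fourier transform, averages over translates, and biases\<close>

definition fourier :: "nat \<Rightarrow> ((nat \<Rightarrow> bit) \<Rightarrow> real) \<Rightarrow> (nat \<Rightarrow> bit) \<Rightarrow> real" where
  "fourier n f y = (\<Sum>x\<in>F2 n. f x * chi n y x)"

text \<open>In characteristic 2 a vector is its own negative, so this is convolution with the
  uniform distribution on \<open>X\<close>. Then \<open>bias\<close> is the Fourier transform of
  that distribution and \<open>fourier_avg\<close> is the convolution theorem. The transform
  \<open>fourier\<close> is not normalised, so inversion carries the factor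
  \<open>card (F2 n)\<close>.\<close>

definition avg :: "(nat \<Rightarrow> bit) set \<Rightarrow> ((nat \<Rightarrow> bit) \<Rightarrow> real) \<Rightarrow> (nat \<Rightarrow> bit) \<Rightarrow> real" where
  "avg X f z = (\<Sum>x\<in>X. f (x + z)) / real (card X)"

definition bias :: "nat \<Rightarrow> (nat \<Rightarrow> bit) set \<Rightarrow> (nat \<Rightarrow> bit) \<Rightarrow> real" where
  "bias n X y = (\<Sum>x\<in>X. chi n y x) / real (card X)"

lemma fourier_inversion:
  assumes "v \<in> F2 n"
  shows "(\<Sum>y\<in>F2 n. fourier n f y * chi n y v) = real (card (F2 n)) * f v"
proof -
  have "(\<Sum>y\<in>F2 n. fourier n f y * chi n y v) = (\<Sum>y\<in>F2 n. \<Sum>x\<in>F2 n. f x * chi n y (x + v))"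
    by (simp add: fourier_def sum_distrib_right chi_add mult.assoc)
  also have "\<dots> = (\<Sum>x\<in>F2 n. \<Sum>y\<in>F2 n. f x * chi n y (x + v))"
    by (rule sum.swap)
  also have "\<dots> = (\<Sum>x\<in>F2 n. f x * (if x + v = 0 then real (card (F2 n)) else 0))"
    using assms by (intro sum.cong refl) (simp add: sum_distrib_left [symmetric] sum_chi_left)
  also have "\<dots> = (\<Sum>x\<in>F2 n. if x = v then f v * real (card (F2 n)) else 0)"
    by (intro sum.cong) (auto simp: f2_add_eq_0_iff)
  also have "\<dots> = real (card (F2 n)) * f v"
    using assms by simp
  finally show ?thesis .
qed

lemma fourier_avg:
  assumes "X \<subseteq> F2 n"
  shows "fourier n (avg X f) y = bias n X y * fourier n f y"
proof -
  have "(\<Sum>z\<in>F2 n. (\<Sum>x\<in>X. f (x + z)) * chi n y z) = (\<Sum>x\<in>X. \<Sum>z\<in>F2 n. f (x + z) * chi n y z)"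
    by (simp add: sum_distrib_right sum.swap [of _ X])
  also have "\<dots> = (\<Sum>x\<in>X. chi n y x * (\<Sum>z\<in>F2 n. f z * chi n y z))"
  proof (intro sum.cong refl)
    fix x assume "x \<in> X"
    then have x: "x \<in> F2 n" using assms by auto
    have "(\<Sum>z\<in>F2 n. f (x + z) * chi n y z) = (\<Sum>z\<in>F2 n. f (x + (x + z)) * chi n y (x + z))"
      by (rule sum_F2_shift [OF x, symmetric])
    then show "(\<Sum>z\<in>F2 n. f (x + z) * chi n y z) = chi n y x * (\<Sum>z\<in>F2 n. f z * chi n y z)"
      by (simp add: chi_add sum_distrib_left algebra_simps)
  qed
  finally show ?thesis
    by (simp add: fourier_def avg_def bias_def sum_distrib_right sum_divide_distrib [symmetric])
qed

lemma bias_parseval: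
  assumes "X \<subseteq> F2 n" "X \<noteq> {}"
  shows "(\<Sum>y\<in>F2 n. (bias n X y)\<^sup>2) = real (card (F2 n)) / real (card X)"
proof -
  have fin: "finite X" using assms(1) finite_F2 by (rule finite_subset)
  have "(\<Sum>y\<in>F2 n. (\<Sum>x\<in>X. chi n y x)\<^sup>2) = (\<Sum>y\<in>F2 n. \<Sum>x\<in>X. \<Sum>x'\<in>X. chi n y (x + x'))"
    by (simp add: power2_eq_square sum_product chi_add)
  also have "\<dots> = (\<Sum>x\<in>X. \<Sum>x'\<in>X. \<Sum>y\<in>F2 n. chi n y (x + x'))"
    by (simp add: sum.swap [of _ X "F2 n"])
  also have "\<dots> = (\<Sum>x\<in>X. \<Sum>x'\<in>X. if x' = x then real (card (F2 n)) else 0)"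
  proof (intro sum.cong refl)
    fix x x' assume "x \<in> X" "x' \<in> X"
    then have "x + x' \<in> F2 n" using assms by (intro F2_add) auto
    then show "(\<Sum>y\<in>F2 n. chi n y (x + x')) = (if x' = x then real (card (F2 n)) else 0)"
      by (auto simp: sum_chi_left f2_add_eq_0_iff)
  qed
  also have "\<dots> = real (card X) * real (card (F2 n))"
    using fin by simp
  finally show ?thesis
    using assms fin
    by (simp add: bias_def power_divide sum_divide_distrib [symmetric] power2_eq_square)
qed

text \<open>A Riesz product: expanding it gives characters indexed by subset sums of
  \<open>S\<close>, and by independence only the empty subset sums to zero, so only the constant
  term survives. The clause on \<open>z\<close> outside the span is the invariant that kills the
  terms created by a new basis vector. The lemma serves as an exponential moment in Chang's bound
  and as the indicator of an annihilator.\<close>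

lemma chi_product_independent:
  assumes "finite S" "f2.independent S" "S \<subseteq> F2 n"
  shows "(\<Sum>x\<in>F2 n. \<Prod>y\<in>S. c y + s y * chi n y x) = real (card (F2 n)) * (\<Prod>y\<in>S. c y)
    \<and> (\<forall>z\<in>F2 n - f2.span S. (\<Sum>x\<in>F2 n. (\<Prod>y\<in>S. c y + s y * chi n y x) * chi n z x) = 0)"
  using assms
proof (induction S rule: finite_induct)
  case empty
  then show ?case using sum_chi by auto
next
  case (insert b S)
  let ?P = "\<lambda>x. \<Prod>y\<in>S. c y + s y * chi n y x"
  have b: "b \<notin> f2.span S" "b \<in> F2 n"
    and IH1: "(\<Sum>x\<in>F2 n. ?P x) = real (card (F2 n)) * (\<Prod>y\<in>S. c y)"
    and IH2: "\<And>z. z \<in> F2 n \<Longrightarrow> z \<notin> f2.span S \<Longrightarrow> (\<Sum>x\<in>F2 n. ?P x * chi n z x) = 0"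
    using insert by (auto simp: f2.independent_insert)
  have "(\<Sum>x\<in>F2 n. \<Prod>y\<in>insert b S. c y + s y * chi n y x)
      = c b * (\<Sum>x\<in>F2 n. ?P x) + s b * (\<Sum>x\<in>F2 n. ?P x * chi n b x)"
    using insert.hyps by (simp add: sum_distrib_left sum.distrib [symmetric] algebra_simps)
  moreover have "(\<Sum>x\<in>F2 n. (\<Prod>y\<in>insert b S. c y + s y * chi n y x) * chi n z x) = 0"
    if z: "z \<in> F2 n" "z \<notin> f2.span (insert b S)" for z
  proof -
    have "z \<notin> f2.span S" using z f2.span_mono [of S "insert b S"] by auto
    moreover have "z + b \<notin> f2.span S"
    proof
      assume "z + b \<in> f2.span S"
      then have "z + b \<in> f2.span (insert b S)" using f2.span_mono [of S "insert b S"] by auto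
      then have "z + b - b \<in> f2.span (insert b S)"
        by (intro f2.span_diff) (auto intro: f2.span_base)
      then show False using z by simp
    qed
    moreover have "(\<Sum>x\<in>F2 n. (\<Prod>y\<in>insert b S. c y + s y * chi n y x) * chi n z x)
      = c b * (\<Sum>x\<in>F2 n. ?P x * chi n z x) + s b * (\<Sum>x\<in>F2 n. ?P x * chi n (z + b) x)"
      using insert.hyps
      by (simp add: sum_distrib_left sum.distrib [symmetric] algebra_simps chi_add_left)
    ultimately show ?thesis using IH2 z b by simp
  qed
  ultimately show ?case using insert.hyps IH1 IH2 b by auto
qed

subsection \<open>Chang's bound and sampling\<close>

lemma exp_le_quadratic:
  fixes x :: real
  assumes "\<bar>x\<bar> \<le> 1"
  shows "exp x \<le> 1 + x + x\<^sup>2"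
proof (cases "x \<ge> 0")
  case True
  then show ?thesis using assms exp_bound by auto
next
  case False
  define y where "y = - x"
  have y: "y > 0" using False by (simp add: y_def)
  have "1 \<le> (1 - y + y\<^sup>2) * (1 + y + y\<^sup>2 / 2)"
  proof -
    have "(1 - y + y\<^sup>2) * (1 + y + y\<^sup>2 / 2) = 1 + y\<^sup>2 / 2 + y ^ 3 / 2 + y ^ 4 / 2"
      by (simp add: field_simps power2_eq_square power3_eq_cube power4_eq_xxxx)
    then show ?thesis using y by simp
  qed
  also have "\<dots> \<le> (1 - y + y\<^sup>2) * exp y"
  proof (rule mult_left_mono)
    show "1 + y + y\<^sup>2 / 2 \<le> exp y" using y by (intro exp_lower_Taylor_quadratic) auto
    have "0 \<le> (1 - y / 2)\<^sup>2 + 3 / 4 * y\<^sup>2" by simp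
    also have "\<dots> = 1 - y + y\<^sup>2" by (simp add: power2_eq_square field_simps)
    finally show "0 \<le> 1 - y + y\<^sup>2" .
  qed
  finally have "exp (- y) \<le> 1 - y + y\<^sup>2"
    by (simp add: exp_minus field_simps)
  then show ?thesis by (simp add: y_def)
qed

text \<open>Exponential moments of a signed character sum \<open>\<phi>\<close>, with d the size of
  \<open>S\<close>: the large biases make the mean of \<open>\<phi>\<close> on \<open>X\<close> at
  least d/8, so by convexity \<open>exp \<phi>\<close> is large there; over the whole space,
  independence turns the moment into a product of hyperbolic cosines, with average at most
  exp(d/16). Comparing the two bounds d.\<close>

lemma chang:
  assumes X: "X \<subseteq> F2 n" "X \<noteq> {}"
    and S: "S \<subseteq> F2 n" "f2.independent S"
    and large: "\<And>y. y \<in> S \<Longrightarrow> \<bar>bias n X y\<bar> \<ge> 1 / 2"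
  shows "real (card S) \<le> 16 * ln (real (card (F2 n)) / real (card X))"
proof -
  have finX: "finite X" using X(1) finite_F2 by (rule finite_subset)
  have finS: "finite S" using S(1) finite_F2 by (rule finite_subset)
  have cX: "real (card X) > 0" using finX X by (simp add: card_gt_0_iff)
  define s where "s = (\<lambda>y. sgn (bias n X y))"
  \<comment> \<open>A scale \<lambda> gains \<lambda>/2 per character and costs \<lambda>^2, by cosh
    \<lambda> \<le> 1 + \<lambda>^2; the value 1/4 maximises the difference.\<close>
  define \<phi> where "\<phi> = (\<lambda>x. \<Sum>y\<in>S. s y * chi n y x / 4)"
  define m where "m = (\<Sum>x\<in>X. \<phi> x) / real (card X)"
  let ?d = "real (card S)"
  have "m = (\<Sum>y\<in>S. s y * bias n X y / 4)"
  proof -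
    have "(\<Sum>x\<in>X. \<phi> x) = (\<Sum>y\<in>S. \<Sum>x\<in>X. s y * chi n y x / 4)"
      unfolding \<phi>_def by (rule sum.swap)
    then show ?thesis
      by (simp add: m_def bias_def sum_divide_distrib sum_distrib_left mult_ac)
  qed
  also have "\<dots> \<ge> (\<Sum>y\<in>S. 1 / 8)"
  proof (rule sum_mono)
    fix y assume "y \<in> S"
    then show "1 / 8 \<le> s y * bias n X y / 4"
      using large [of y] by (simp add: s_def abs_sgn [symmetric] mult.commute)
  qed
  finally have m: "m \<ge> ?d / 8" by simp
  \<comment> \<open>Jensen's inequality through the tangent line of \<open>exp\<close> at the mean
    \<open>m\<close>: the linear terms cancel in the sum.\<close>
  have "real (card X) * exp m = (\<Sum>x\<in>X. exp m * (1 + (\<phi> x - m)))"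
    using cX by (simp add: sum_distrib_left [symmetric] sum.distrib sum_subtractf m_def)
  also have "\<dots> \<le> (\<Sum>x\<in>X. exp (\<phi> x))"
  proof (rule sum_mono)
    fix x
    have "exp m * (1 + (\<phi> x - m)) \<le> exp m * exp (\<phi> x - m)"
      using exp_ge_add_one_self [of "\<phi> x - m"] by (intro mult_left_mono) auto
    then show "exp m * (1 + (\<phi> x - m)) \<le> exp (\<phi> x)" by (simp add: exp_diff)
  qed
  also have "\<dots> \<le> (\<Sum>x\<in>F2 n. exp (\<phi> x))"
    using X by (intro sum_mono2) auto
  also have "\<dots> = (\<Sum>x\<in>F2 n. \<Prod>y\<in>S. cosh (1 / 4) + (s y * sinh (1 / 4)) * chi n y x)"
  proof (intro sum.cong refl)
    fix x
    \<comment> \<open>The exponent is a sign times 1/4, and on signs the exponential is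
      affine.\<close>
    have "exp (s y * chi n y x / 4) = cosh (1 / 4) + (s y * sinh (1 / 4)) * chi n y x"
      if "y \<in> S" for y
    proof -
      have "s y = 1 \<or> s y = - 1" using large [OF that] by (auto simp: s_def sgn_if)
      then show ?thesis using chi_cases [of n y x]
        by (auto simp: cosh_def sinh_def scaleR_conv_of_real field_simps)
    qed
    then show "exp (\<phi> x) = (\<Prod>y\<in>S. cosh (1 / 4) + (s y * sinh (1 / 4)) * chi n y x)"
      unfolding \<phi>_def using finS by (simp add: exp_sum)
  qed
  also have "\<dots> = real (card (F2 n)) * cosh (1 / 4) ^ card S"
    using chi_product_independent [OF finS S(2) S(1), of "\<lambda>_. cosh (1 / 4)" "\<lambda>y. s y * sinh (1 / 4)"]
    by simp
  also have "\<dots> \<le> real (card (F2 n)) * exp (1 / 16) ^ card S"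
  proof -
    have "cosh (1 / 4) \<le> (1 + 1 / 16 :: real)"
      using exp_le_quadratic [of "1 / 4"] exp_le_quadratic [of "- 1 / 4"]
      by (simp add: cosh_def power2_eq_square)
    also have "\<dots> \<le> exp (1 / 16)" by (rule exp_ge_add_one_self)
    finally show ?thesis by (intro mult_left_mono power_mono) auto
  qed
  also have "\<dots> = real (card (F2 n)) * exp (?d / 16)"
    by (simp add: exp_of_nat_mult [symmetric])
  finally have le: "real (card X) * exp m \<le> real (card (F2 n)) * exp (?d / 16)" .
  have "real (card X) * exp (?d / 8) \<le> real (card X) * exp m"
    using m by (intro mult_left_mono) auto
  also note le
  finally have "real (card X) * exp (?d / 8) / exp (?d / 16) \<le> real (card (F2 n))"
    by (simp add: pos_divide_le_eq)
  then have "exp (?d / 8 - ?d / 16) \<le> real (card (F2 n)) / real (card X)"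
    unfolding exp_diff using cX by (simp add: pos_le_divide_eq mult.commute)
  then have "?d / 8 - ?d / 16 \<le> ln (real (card (F2 n)) / real (card X))"
    using cX by (subst ln_ge_iff) (auto intro: divide_pos_pos)
  then show ?thesis by simp
qed

section \<open>Exponential tail bounds for sampled sums, by counting tuples\<close>

lemma sampling_upper_tail:
  fixes w :: "'a \<Rightarrow> real"
  assumes A: "finite A" "A \<noteq> {}" and w: "\<And>x. x \<in> A \<Longrightarrow> \<bar>w x\<bar> \<le> 2" "(\<Sum>x\<in>A. w x) = 0"
    and e: "0 < e" "e \<le> 1"
  shows "real (card {a \<in> PiE {..<q} (\<lambda>_. A). (\<Sum>i<q. w (a i)) > real q * e})
    \<le> exp (- real q * e\<^sup>2 / 16) * real (card A) ^ q"
proof -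
  let ?P = "PiE {..<q} (\<lambda>_. A)"
  let ?B = "{a \<in> ?P. (\<Sum>i<q. w (a i)) > real q * e}"
  \<comment> \<open>This value minimises \<open>4 * l\<^sup>2 - l * e\<close>, and it keeps
    \<open>l * w x\<close> within [-1/4, 1/4], where \<open>exp_le_quadratic\<close>
    applies.\<close>
  define l where "l = e / 8"
  have finP: "finite ?P" using A by (intro finite_PiE) auto
  have "real (card ?B) * exp (l * (real q * e)) = (\<Sum>a\<in>?B. exp (l * (real q * e)))"
    by simp
  also have "\<dots> \<le> (\<Sum>a\<in>?B. exp (l * (\<Sum>i<q. w (a i))))"
    using e by (intro sum_mono) (auto simp: l_def)
  also have "\<dots> \<le> (\<Sum>a\<in>?P. exp (l * (\<Sum>i<q. w (a i))))"
    using finP by (intro sum_mono2) auto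
  also have "\<dots> = (\<Sum>a\<in>?P. \<Prod>i<q. exp (l * w (a i)))"
    by (simp add: exp_sum sum_distrib_left)
  also have "\<dots> = (\<Prod>i<q. \<Sum>x\<in>A. exp (l * w x))"
    using A by (subst prod_sum_PiE) auto
  also have "\<dots> = (\<Sum>x\<in>A. exp (l * w x)) ^ q" by simp
  also have "\<dots> \<le> (real (card A) * exp (4 * l\<^sup>2)) ^ q"
  proof (rule power_mono)
    have "(\<Sum>x\<in>A. exp (l * w x)) \<le> (\<Sum>x\<in>A. 1 + l * w x + 4 * l\<^sup>2)"
    proof (rule sum_mono)
      fix x assume "x \<in> A"
      then have wx: "\<bar>w x\<bar> \<le> 2" using w by auto
      have "\<bar>l * w x\<bar> \<le> 1 / 8 * 2"
        unfolding abs_mult using wx e by (intro mult_mono) (auto simp: l_def)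
      then have "exp (l * w x) \<le> 1 + l * w x + (l * w x)\<^sup>2"
        by (intro exp_le_quadratic) auto
      also have "(l * w x)\<^sup>2 \<le> l\<^sup>2 * 4"
        unfolding power_mult_distrib using wx power_mono [of "\<bar>w x\<bar>" 2 2]
        by (intro mult_left_mono) auto
      finally show "exp (l * w x) \<le> 1 + l * w x + 4 * l\<^sup>2" by simp
    qed
    also have "\<dots> = real (card A) * (1 + 4 * l\<^sup>2)"
      using w by (simp add: sum.distrib sum_distrib_left [symmetric] algebra_simps)
    also have "\<dots> \<le> real (card A) * exp (4 * l\<^sup>2)"
      by (intro mult_left_mono exp_ge_add_one_self) auto
    finally show "(\<Sum>x\<in>A. exp (l * w x)) \<le> real (card A) * exp (4 * l\<^sup>2)" .
  qed (auto intro: sum_nonneg)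
  also have "\<dots> = real (card A) ^ q * exp (real q * (4 * l\<^sup>2))"
    by (simp add: power_mult_distrib exp_of_nat_mult)
  finally have "real (card ?B) \<le> real (card A) ^ q * exp (real q * (4 * l\<^sup>2)) / exp (l * (real q * e))"
    by (simp add: field_simps)
  also have "\<dots> = real (card A) ^ q * exp (real q * (4 * l\<^sup>2) - l * (real q * e))"
    by (simp add: exp_diff)
  also have "real q * (4 * l\<^sup>2) - l * (real q * e) = - real q * e\<^sup>2 / 16"
    by (simp add: l_def power2_eq_square field_simps)
  finally show ?thesis by (simp add: mult.commute)
qed

lemma sampling_deviation:
  fixes u :: "'a \<Rightarrow> real"
  assumes A: "finite A" "A \<noteq> {}" and u: "\<And>x. x \<in> A \<Longrightarrow> 0 \<le> u x \<and> u x \<le> 2"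
    and m: "m = (\<Sum>x\<in>A. u x) / real (card A)" and e: "0 < e" "e \<le> 1"
  shows "real (card {a \<in> PiE {..<q} (\<lambda>_. A). \<bar>(\<Sum>i<q. u (a i)) - real q * m\<bar> > real q * e})
    \<le> 2 * exp (- real q * e\<^sup>2 / 16) * real (card A) ^ q"
proof -
  let ?P = "PiE {..<q} (\<lambda>_. A)"
  let ?U = "\<lambda>w. {a \<in> ?P. (\<Sum>i<q. w (a i)) > real q * e}"
  have finP: "finite ?P" using A by (intro finite_PiE) auto
  have cA: "real (card A) > 0" using A by (simp add: card_gt_0_iff)
  have m0: "m \<ge> 0" unfolding m using u by (intro divide_nonneg_nonneg sum_nonneg) auto
  have "(\<Sum>x\<in>A. u x) \<le> (\<Sum>x\<in>A. 2)" using u by (intro sum_mono) auto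
  then have m2: "m \<le> 2" unfolding m using cA by (simp add: divide_le_eq mult.commute)
  have su: "(\<Sum>x\<in>A. u x) = m * real (card A)" unfolding m using cA by simp
  have 1: "real (card (?U (\<lambda>x. u x - m))) \<le> exp (- real q * e\<^sup>2 / 16) * real (card A) ^ q"
  proof (rule sampling_upper_tail [OF A _ _ e])
    fix x assume "x \<in> A" then show "\<bar>u x - m\<bar> \<le> 2" using u [of x] m0 m2 by auto
  qed (simp add: sum_subtractf su)
  have 2: "real (card (?U (\<lambda>x. m - u x))) \<le> exp (- real q * e\<^sup>2 / 16) * real (card A) ^ q"
  proof (rule sampling_upper_tail [OF A _ _ e])
    fix x assume "x \<in> A" then show "\<bar>m - u x\<bar> \<le> 2" using u [of x] m0 m2 by auto
  qed (simp add: sum_subtractf su)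
  have "{a \<in> ?P. \<bar>(\<Sum>i<q. u (a i)) - real q * m\<bar> > real q * e}
      \<subseteq> ?U (\<lambda>x. u x - m) \<union> ?U (\<lambda>x. m - u x)"
  proof
    fix a assume "a \<in> {a \<in> ?P. \<bar>(\<Sum>i<q. u (a i)) - real q * m\<bar> > real q * e}"
    then have "a \<in> ?P" "\<bar>(\<Sum>i<q. u (a i)) - real q * m\<bar> > real q * e" by blast+
    moreover have "(\<Sum>i<q. u (a i) - m) = (\<Sum>i<q. u (a i)) - real q * m"
      "(\<Sum>i<q. m - u (a i)) = real q * m - (\<Sum>i<q. u (a i))"
      by (simp_all add: sum_subtractf)
    ultimately show "a \<in> ?U (\<lambda>x. u x - m) \<union> ?U (\<lambda>x. m - u x)"
      unfolding Un_iff mem_Collect_eq by linarith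
  qed
  then have "card {a \<in> ?P. \<bar>(\<Sum>i<q. u (a i)) - real q * m\<bar> > real q * e}
      \<le> card (?U (\<lambda>x. u x - m) \<union> ?U (\<lambda>x. m - u x))"
    using finP by (intro card_mono) auto
  also have "\<dots> \<le> card (?U (\<lambda>x. u x - m)) + card (?U (\<lambda>x. m - u x))"
    by (rule card_Un_le)
  finally show ?thesis using 1 2 by linarith
qed

subsection \<open>Almost periods\<close>

lemma avg_bounds:
  assumes "\<And>x. 0 \<le> g x \<and> g x \<le> 2"
  shows "0 \<le> avg X g z \<and> avg X g z \<le> 2"
proof -
  have "(\<Sum>x\<in>X. g (x + z)) \<le> (\<Sum>x\<in>X. 2)" using assms by (intro sum_mono) auto
  moreover have "0 \<le> (\<Sum>x\<in>X. g (x + z))" using assms by (intro sum_nonneg) auto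
  ultimately show ?thesis
    by (cases "card X = 0") (auto simp: avg_def pos_divide_le_eq)
qed

text \<open>A random \<open>q\<close>-tuple from \<open>A\<close> determines \<open>avg A g\<close>
  up to \<open>e\<close> at most points. Shifting good tuples by elements of \<open>B\<close> lands
  in only \<open>card (A + B) ^ q\<close> tuples, so by pigeonhole some tuple \<open>c\<close> is
  reached by many shifts. Two such shifts make the same sample sum approximate two translates of
  \<open>avg A g\<close>; hence these translates nearly agree off a small set, and averaging over
  \<open>B\<close> absorbs that set.\<close>

lemma croot_sisask:
  assumes A: "A \<subseteq> F2 n" "A \<noteq> {}" and B: "B \<subseteq> F2 n" "B \<noteq> {}"
    and g: "\<And>x. 0 \<le> g x \<and> g x \<le> 2"
    and r: "real (card (A + B)) \<le> r * real (card A)"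
    and e: "0 < e" "e \<le> 1" and q: "q > 0"
    and samples: "4 * real (card (F2 n)) * exp (- real q * e\<^sup>2 / 16) \<le> e * real (card B)"
  obtains X where "X \<subseteq> F2 n" "X \<noteq> {}" "real (card B) \<le> 2 * r ^ q * real (card X)"
    "\<And>x s. x \<in> X \<Longrightarrow> s \<in> F2 n \<Longrightarrow>
      \<bar>avg B (avg A g) (x + s) - avg B (avg A g) s\<bar> \<le> 6 * e"
proof -
  have finA: "finite A" using A(1) finite_F2 by (rule finite_subset)
  have finB: "finite B" using B(1) finite_F2 by (rule finite_subset)
  have cA: "real (card A) > 0" using finA A by (simp add: card_gt_0_iff)
  have cB: "real (card B) > 0" using finB B by (simp add: card_gt_0_iff)
  let ?G = "F2 n"
  define h where "h = avg A g"
  define P where "P = PiE {..<q} (\<lambda>_. A)"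
  define Q where "Q = PiE {..<q} (\<lambda>_. A + B)"
  have finAB: "finite (A + B)" using finA finB by (rule finite_set_plus)
  have finP: "finite P" unfolding P_def using finA by (intro finite_PiE) auto
  have finQ: "finite Q" unfolding Q_def using finAB by (intro finite_PiE) auto
  have cP: "card P = card A ^ q" unfolding P_def by (simp add: card_PiE)
  have cQ: "card Q = card (A + B) ^ q" unfolding Q_def by (simp add: card_PiE)
  define bad where "bad = (\<lambda>a. {z \<in> ?G. \<bar>(\<Sum>i<q. g (a i + z)) - real q * h z\<bar> > real q * e})"
  have finbad: "finite (bad a)" for a unfolding bad_def by simp
  \<comment> \<open>The threshold is what averaging over \<open>B\<close> absorbs: a set of this
    size covers a proportion of at most \<open>e\<close> of \<open>B\<close>. By
    \<open>total\<close> and Markov's inequality, at least half of the tuples are good.\<close>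
  define Good where "Good = {a \<in> P. real (card (bad a)) \<le> e * real (card B)}"
  have total: "(\<Sum>a\<in>P. real (card (bad a))) \<le> e * real (card B) / 2 * real (card A) ^ q"
  proof -
    let ?R = "\<lambda>a z. \<bar>(\<Sum>i<q. g (a i + z)) - real q * h z\<bar> > real q * e"
    have "(\<Sum>a\<in>P. real (card (bad a))) = (\<Sum>a\<in>P. \<Sum>z\<in>?G. if ?R a z then 1 else 0)"
      by (intro sum.cong refl) (simp add: bad_def sum.If_cases Int_def)
    also have "\<dots> = (\<Sum>z\<in>?G. \<Sum>a\<in>P. if ?R a z then 1 else 0)"
      by (rule sum.swap)
    also have "\<dots> = (\<Sum>z\<in>?G. real (card {a \<in> P. ?R a z}))"
      using finP by (intro sum.cong refl) (simp add: sum.If_cases Int_def)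
    also have "\<dots> \<le> (\<Sum>z\<in>?G. 2 * exp (- real q * e\<^sup>2 / 16) * real (card A) ^ q)"
    proof (rule sum_mono)
      fix z
      show "real (card {a \<in> P. ?R a z}) \<le> 2 * exp (- real q * e\<^sup>2 / 16) * real (card A) ^ q"
        unfolding P_def
        by (rule sampling_deviation [OF finA A(2), of "\<lambda>x. g (x + z)"])
          (use g e in \<open>auto simp: h_def avg_def\<close>)
    qed
    also have "\<dots> = 4 * real (card ?G) * exp (- real q * e\<^sup>2 / 16) * real (card A) ^ q / 2"
      by simp
    also have "\<dots> \<le> e * real (card B) * real (card A) ^ q / 2"
      using samples by (intro divide_right_mono mult_right_mono) auto
    finally show ?thesis by simp
  qed
  have good: "real (card Good) \<ge> real (card A) ^ q / 2"
  proof -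
    have "real (card (P - Good)) * (e * real (card B)) = (\<Sum>a\<in>P - Good. e * real (card B))"
      by simp
    also have "\<dots> \<le> (\<Sum>a\<in>P - Good. real (card (bad a)))"
      by (intro sum_mono) (auto simp: Good_def)
    also have "\<dots> \<le> (\<Sum>a\<in>P. real (card (bad a)))"
      using finP by (intro sum_mono2) auto
    also have "\<dots> \<le> (real (card A) ^ q / 2) * (e * real (card B))"
      using total by (simp add: mult_ac)
    finally have "real (card (P - Good)) \<le> real (card A) ^ q / 2"
      by (rule mult_right_le_imp_le) (use e cB in simp)
    moreover have "card P = card Good + card (P - Good)"
      using finP by (subst card_Diff_subset) (auto simp: Good_def card_mono)
    moreover have "real (card P) = real (card A) ^ q" using cP by simp
    ultimately show ?thesis by linarith
  qed
  \<comment> \<open>The shifts in \<open>B\<close> that carry a tuple of \<open>A + B\<close> to a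
    good tuple of \<open>A\<close>. Their average number over \<open>Q\<close> gives the factor
    \<open>2 * r ^ q\<close>.\<close>
  define X0 where "X0 = (\<lambda>c. {t \<in> B. (\<lambda>i\<in>{..<q}. c i + t) \<in> Good})"
  have finX0: "finite (X0 c)" for c unfolding X0_def using finB by simp
  have count: "card Good * card B \<le> (\<Sum>c\<in>Q. card (X0 c))"
  proof -
    have "card Good * card B = card (Good \<times> B)" by (simp add: card_cartesian_product)
    also have "\<dots> \<le> card (Sigma Q X0)"
    proof (rule card_inj_on_le)
      \<comment> \<open>Recording \<open>t\<close> makes the map injective, since adding
        \<open>t\<close> again recovers the good tuple.\<close>
      let ?f = "\<lambda>(a, t). ((\<lambda>i\<in>{..<q}. a i + t), t)"
      have unshift: "(\<lambda>i\<in>{..<q}. (\<lambda>i\<in>{..<q}. a i + t) i + t) = a" if "a \<in> P" for a t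
      proof
        fix i
        show "(\<lambda>i\<in>{..<q}. (\<lambda>i\<in>{..<q}. a i + t) i + t) i = a i"
          using that by (cases "i < q") (auto simp: P_def PiE_def extensional_def add.assoc)
      qed
      have GP: "a \<in> P" if "a \<in> Good" for a using that by (simp add: Good_def)
      show "inj_on ?f (Good \<times> B)"
      proof (rule inj_onI)
        fix x y assume x: "x \<in> Good \<times> B" and y: "y \<in> Good \<times> B" and eq: "?f x = ?f y"
        obtain a t a' t' where xy: "x = (a, t)" "y = (a', t')" by fastforce
        have "t = t'" and eq': "(\<lambda>i\<in>{..<q}. a i + t) = (\<lambda>i\<in>{..<q}. a' i + t')"
          using eq xy by auto
        have "a = (\<lambda>i\<in>{..<q}. (\<lambda>i\<in>{..<q}. a i + t) i + t)"
          using unshift GP x xy by (metis mem_Sigma_iff)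
        also have "\<dots> = (\<lambda>i\<in>{..<q}. (\<lambda>i\<in>{..<q}. a' i + t') i + t')"
          using eq' \<open>t = t'\<close> by simp
        also have "\<dots> = a'" using unshift GP y xy by (metis mem_Sigma_iff)
        finally show "x = y" using xy \<open>t = t'\<close> by simp
      qed
      show "?f ` (Good \<times> B) \<subseteq> Sigma Q X0"
      proof
        fix p assume "p \<in> ?f ` (Good \<times> B)"
        then obtain a t where a: "a \<in> Good" "t \<in> B" and p: "p = ((\<lambda>i\<in>{..<q}. a i + t), t)"
          by auto
        have "a i \<in> A" if "i < q" for i using GP [OF a(1)] that by (auto simp: P_def)
        then have "(\<lambda>i\<in>{..<q}. a i + t) \<in> Q"
          using a(2) by (auto simp: Q_def intro: set_plus_intro)
        moreover have "t \<in> X0 (\<lambda>i\<in>{..<q}. a i + t)"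
          unfolding X0_def using a unshift [OF GP [OF a(1)]] by simp
        ultimately show "p \<in> Sigma Q X0" using p by auto
      qed
      show "finite (Sigma Q X0)" using finQ finX0 by auto
    qed
    also have "\<dots> = (\<Sum>c\<in>Q. card (X0 c))" using finQ finX0 by simp
    finally show ?thesis .
  qed
  have "\<exists>c\<in>Q. card Good * card B \<le> card Q * card (X0 c)"
  proof (rule ccontr)
    assume "\<not> ?thesis"
    then have lt: "\<And>c. c \<in> Q \<Longrightarrow> card Q * card (X0 c) < card Good * card B" by force
    have "Q \<noteq> {}" unfolding Q_def using A B
      by (auto simp: PiE_eq_empty_iff intro: set_plus_intro)
    then have "(\<Sum>c\<in>Q. card Q * card (X0 c)) < (\<Sum>c\<in>Q. card Good * card B)"
      using lt finQ by (intro sum_strict_mono) auto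
    then have "card Q * (\<Sum>c\<in>Q. card (X0 c)) < card Q * (card Good * card B)"
      by (simp add: sum_distrib_left)
    then show False using count by simp
  qed
  then obtain c where c: "card Good * card B \<le> card Q * card (X0 c)" by blast
  have size: "real (card B) \<le> 2 * r ^ q * real (card (X0 c))"
  proof -
    have "real (card A) ^ q / 2 * real (card B) \<le> real (card Good) * real (card B)"
      using good by (intro mult_right_mono) auto
    also have "\<dots> \<le> real (card Q) * real (card (X0 c))"
      using c by (metis of_nat_le_iff of_nat_mult)
    also have "\<dots> \<le> (r * real (card A)) ^ q * real (card (X0 c))"
      unfolding cQ of_nat_power using r by (intro mult_right_mono power_mono) auto
    finally have "real (card A) ^ q * real (card B)
        \<le> real (card A) ^ q * (2 * r ^ q * real (card (X0 c)))"
      by (simp add: power_mult_distrib mult_ac)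
    then show ?thesis
      by (rule mult_left_le_imp_le) (use cA in simp)
  qed
  have "X0 c \<noteq> {}"
  proof
    assume "X0 c = {}"
    then show False using size cB by simp
  qed
  then obtain t0 where t0: "t0 \<in> X0 c" by blast
  \<comment> \<open>The sample sum here depends on \<open>c\<close> and not on \<open>t\<close>, so
    one and the same quantity approximates both \<open>h (z + t)\<close> and
    \<open>h (z + t0)\<close>.\<close>
  define E where
    "E = (\<lambda>t. {z \<in> ?G. \<bar>(\<Sum>i<q. g (c i + z)) - real q * h (z + t)\<bar> > real q * e})"
  have finE: "finite (E t)" for t unfolding E_def by simp
  have cE: "real (card (E t)) \<le> e * real (card B)" if "t \<in> X0 c" for t
  proof -
    let ?a = "\<lambda>i\<in>{..<q}. c i + t"
    have t: "t \<in> ?G" "?a \<in> Good" using that B by (auto simp: X0_def)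
    have "E t \<subseteq> (+) t ` bad ?a"
    proof
      fix z assume z: "z \<in> E t"
      have "t + z \<in> bad ?a"
        using z t(1) by (auto simp: E_def bad_def add_ac)
      then show "z \<in> (+) t ` bad ?a" by (metis f2_add_cancel image_eqI)
    qed
    then have "card (E t) \<le> card (bad ?a)"
      using finbad by (metis card_image_le card_mono finite_imageI order.trans)
    then show ?thesis using t(2) unfolding Good_def by simp
  qed
  have hb: "0 \<le> h z \<and> h z \<le> 2" for z
    unfolding h_def using g by (rule avg_bounds)
  have ap: "\<bar>avg B h (t0 + t + s) - avg B h s\<bar> \<le> 6 * e" if t: "t \<in> X0 c" and s: "s \<in> ?G" for t s
  proof -
    let ?U = "E t \<union> E t0"
    have t0G: "t0 \<in> ?G" using t0 B by (auto simp: X0_def)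
    have ptw: "\<bar>h (b + (t0 + t + s)) - h (b + s)\<bar> \<le> 2 * e + (if b + s + t0 \<in> ?U then 2 else 0)"
      if b: "b \<in> B" for b
    proof -
      define z where "z = b + s + t0"
      have zG: "z \<in> ?G" using b B s t0G unfolding z_def by (intro F2_add) auto
      have z1: "b + (t0 + t + s) = z + t" and z2: "b + s = z + t0"
        by (simp_all add: z_def add_ac)
      have "\<bar>h (z + t) - h (z + t0)\<bar> \<le> 2 * e + (if z \<in> ?U then 2 else 0)"
      proof (cases "z \<in> ?U")
        case True
        then have "2 \<le> 2 * e + (if z \<in> ?U then 2 else 0)" using e by simp
        then show ?thesis using hb [of "z + t"] hb [of "z + t0"] by linarith
      next
        case False
        then have "\<bar>(\<Sum>i<q. g (c i + z)) - real q * h (z + t)\<bar> \<le> real q * e"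
          "\<bar>(\<Sum>i<q. g (c i + z)) - real q * h (z + t0)\<bar> \<le> real q * e"
          using zG unfolding E_def by auto
        then have "\<bar>real q * h (z + t) - real q * h (z + t0)\<bar> \<le> 2 * (real q * e)" by linarith
        then have "real q * \<bar>h (z + t) - h (z + t0)\<bar> \<le> real q * (2 * e)"
          by (simp add: abs_mult right_diff_distrib [symmetric])
        then have "\<bar>h (z + t) - h (z + t0)\<bar> \<le> 2 * e"
          using q by simp
        then show ?thesis using False by simp
      qed
      then show ?thesis unfolding z1 [symmetric] z2 [symmetric] unfolding z_def .
    qed
    have "\<bar>(\<Sum>b\<in>B. h (b + (t0 + t + s))) - (\<Sum>b\<in>B. h (b + s))\<bar>
        \<le> (\<Sum>b\<in>B. \<bar>h (b + (t0 + t + s)) - h (b + s)\<bar>)"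
      unfolding sum_subtractf [symmetric] by (rule sum_abs)
    also have "\<dots> \<le> (\<Sum>b\<in>B. 2 * e + (if b + s + t0 \<in> ?U then 2 else 0))"
      by (intro sum_mono ptw)
    also have "\<dots> = 2 * e * real (card B) + 2 * real (card {b \<in> B. b + s + t0 \<in> ?U})"
      using finB by (simp add: sum.distrib sum.If_cases Int_def)
    also have "real (card {b \<in> B. b + s + t0 \<in> ?U}) \<le> real (card (E t)) + real (card (E t0))"
    proof -
      have "card {b \<in> B. b + s + t0 \<in> ?U} \<le> card ?U"
        by (rule card_inj_on_le [of "\<lambda>b. b + s + t0"]) (use finE in \<open>auto simp: inj_on_def\<close>)
      then show ?thesis using card_Un_le [of "E t" "E t0"] by linarith
    qed
    also have "\<dots> \<le> 2 * (e * real (card B))" using cE [OF t] cE [OF t0] by simp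
    \<comment> \<open>The 6 is 2 + 2 * 2: the sampling errors of two shifts, plus a jump of
      \<open>h\<close> by at most 2 on two exceptional sets, each of size at most
      \<open>e * card B\<close>.\<close>
    finally have "\<bar>(\<Sum>b\<in>B. h (b + (t0 + t + s))) - (\<Sum>b\<in>B. h (b + s))\<bar> \<le> 6 * e * real (card B)"
      by simp
    then show ?thesis using cB
      by (simp add: avg_def diff_divide_distrib [symmetric] pos_divide_le_eq)
  qed
  show thesis
  proof
    show "(+) t0 ` X0 c \<subseteq> ?G" "(+) t0 ` X0 c \<noteq> {}"
      using B t0 by (auto simp: X0_def intro!: F2_add)
    show "real (card B) \<le> 2 * r ^ q * real (card ((+) t0 ` X0 c))"
      using size by (simp add: card_image)
    fix x s assume "x \<in> (+) t0 ` X0 c" "s \<in> ?G"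
    then show "\<bar>avg B (avg A g) (x + s) - avg B (avg A g) s\<bar> \<le> 6 * e"
      using ap by (auto simp: h_def)
  qed
qed

lemma avg_commute: "avg X (avg Y f) = avg Y (avg X f)"
proof
  fix z
  have "(\<Sum>x\<in>X. \<Sum>y\<in>Y. f (y + (x + z))) = (\<Sum>y\<in>Y. \<Sum>x\<in>X. f (x + (y + z)))"
    by (subst sum.swap) (simp add: add_ac)
  then show "avg X (avg Y f) z = avg Y (avg X f) z"
    by (simp add: avg_def sum_divide_distrib [symmetric] mult.commute)
qed

lemma avg_le_some:
  assumes "finite X" "X \<noteq> {}"
  obtains x where "x \<in> X" "avg X f z \<le> f (x + z)"
proof (rule ccontr)
  assume "\<not> thesis"
  then have "\<And>x. x \<in> X \<Longrightarrow> f (x + z) < avg X f z" using that by force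
  then have "(\<Sum>x\<in>X. f (x + z)) < (\<Sum>x\<in>X. avg X f z)"
    using assms by (intro sum_strict_mono) auto
  then show False using assms by (simp add: avg_def)
qed

lemma avg_close:
  assumes "\<And>x. x \<in> X \<Longrightarrow> \<bar>f (x + z) - c\<bar> \<le> d" "finite X" "X \<noteq> {}"
  shows "\<bar>avg X f z - c\<bar> \<le> d"
proof -
  have cX: "real (card X) > 0" using assms by (simp add: card_gt_0_iff)
  have "avg X f z - c = (\<Sum>x\<in>X. f (x + z) - c) / real (card X)"
    using cX by (simp add: avg_def sum_subtractf field_simps)
  moreover have "\<bar>\<Sum>x\<in>X. f (x + z) - c\<bar> \<le> (\<Sum>x\<in>X. d)"
    using assms by (intro order.trans [OF sum_abs] sum_mono) auto
  ultimately show ?thesis using cX by (simp add: pos_divide_le_eq mult.commute)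
qed

section \<open>From almost periods to a subspace\<close>

lemma avg_iterate_close:
  assumes X: "X \<subseteq> F2 n" "X \<noteq> {}"
    and ap: "\<And>x s. x \<in> X \<Longrightarrow> s \<in> F2 n \<Longrightarrow> \<bar>H (x + s) - H s\<bar> \<le> \<delta>" and s: "s \<in> F2 n"
  shows "\<bar>(avg X ^^ l) H s - H s\<bar> \<le> real l * \<delta>"
  using s
proof (induction l arbitrary: s)
  case 0
  then show ?case by simp
next
  case (Suc l)
  have "finite X" using X(1) finite_F2 by (rule finite_subset)
  have "\<bar>avg X ((avg X ^^ l) H) s - H s\<bar> \<le> real (Suc l) * \<delta>"
  proof (rule avg_close [OF _ \<open>finite X\<close> X(2)])
    fix x assume x: "x \<in> X"
    then have "x + s \<in> F2 n" using X Suc.prems by (intro F2_add) auto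
    then have "\<bar>(avg X ^^ l) H (x + s) - H (x + s)\<bar> \<le> real l * \<delta>" by (rule Suc.IH)
    moreover have "\<bar>H (x + s) - H s\<bar> \<le> \<delta>" using ap x Suc.prems by blast
    ultimately show "\<bar>(avg X ^^ l) H (x + s) - H s\<bar> \<le> real (Suc l) * \<delta>"
      unfolding of_nat_Suc distrib_right by linarith
  qed
  then show ?case by simp
qed

lemma fourier_avg_iterate:
  assumes "X \<subseteq> F2 n"
  shows "fourier n ((avg X ^^ l) f) y = bias n X y ^ l * fourier n f y"
  by (induction l) (simp_all add: fourier_avg [OF assms])

text \<open>The indicator of \<open>V\<close> is the product over \<open>S\<close> of (1 +
  character)/2, so the Riesz product identity counts \<open>V\<close> exactly.\<close>

lemma chi_annihilator:
  assumes S: "S \<subseteq> F2 n" "f2.independent S"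
  defines "V \<equiv> {v \<in> F2 n. \<forall>y\<in>S. chi n y v = 1}"
  shows "f2.subspace V" and "card V * 2 ^ card S = card (F2 n)"
    and "\<And>y v. y \<in> f2.span S \<Longrightarrow> v \<in> V \<Longrightarrow> chi n y v = 1"
proof -
  have finS: "finite S" using S(1) finite_F2 by (rule finite_subset)
  show "f2.subspace V"
    by (rule f2_subspaceI) (auto simp: V_def chi_add)
  have "real (card V) = (\<Sum>x\<in>F2 n. if x \<in> V then 1 else 0)"
    by (simp add: sum.If_cases V_def Int_def)
  also have "\<dots> = (\<Sum>x\<in>F2 n. \<Prod>y\<in>S. 1 / 2 + 1 / 2 * chi n y x)"
  proof (intro sum.cong refl)
    fix x assume x: "x \<in> F2 n"
    show "(if x \<in> V then 1 else 0) = (\<Prod>y\<in>S. 1 / 2 + 1 / 2 * chi n y x)"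
    proof (cases "x \<in> V")
      case True
      then show ?thesis by (auto simp: V_def)
    next
      case False
      then obtain y where "y \<in> S" "chi n y x = - 1" using chi_cases x by (auto simp: V_def)
      then have "(\<Prod>y\<in>S. 1 / 2 + 1 / 2 * chi n y x) = 0"
        using finS by (intro prod_zero bexI [of _ y]) auto
      then show ?thesis using False by simp
    qed
  qed
  also have "\<dots> = real (card (F2 n)) * (1 / 2) ^ card S"
    using chi_product_independent [OF finS S(2) S(1), of "\<lambda>_. 1 / 2" "\<lambda>_. 1 / 2"] by simp
  finally have "real (card V * 2 ^ card S) = real (card (F2 n))"
    by (simp add: power_divide)
  then show "card V * 2 ^ card S = card (F2 n)" by (simp only: of_nat_eq_iff)
  show "chi n y v = 1" if "y \<in> f2.span S" "v \<in> V" for y v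
  proof -
    have "f2.subspace {y. chi n y v = 1}"
      by (rule f2_subspaceI) (auto simp: chi_add_left)
    then have "f2.span S \<subseteq> {y. chi n y v = 1}"
      using that(2) by (intro f2.span_minimal) (auto simp: V_def)
    then show ?thesis using that by auto
  qed
qed

text \<open>Each averaging over \<open>X\<close> multiplies a Fourier coefficient by the bias at
  that frequency. Frequencies of large bias are absent from \<open>g\<close> or do not see
  \<open>v\<close>; all others at least halve in every round, and the averages over the dense sets
  \<open>A\<close> and \<open>B\<close> make the remainder summable by Parseval.\<close>

lemma fourier_small_shift:
  fixes l :: nat
  assumes A: "A \<subseteq> F2 n" "A \<noteq> {}" and B: "B \<subseteq> F2 n" "B \<noteq> {}" and X: "X \<subseteq> F2 n"
    and g: "\<And>x. 0 \<le> g x \<and> g x \<le> 2"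
    and KA: "real (card (F2 n)) \<le> K * real (card A)" and KB: "real (card (F2 n)) \<le> K * real (card B)"
    and v: "v \<in> F2 n"
    and triv: "\<And>y. y \<in> F2 n \<Longrightarrow> \<bar>bias n X y\<bar> \<ge> 1 / 2 \<Longrightarrow> fourier n g y \<noteq> 0 \<Longrightarrow> chi n y v = 1"
  defines "F \<equiv> (avg X ^^ l) (avg B (avg A g))"
  shows "\<bar>F v - F 0\<bar> \<le> 4 * K / 2 ^ l"
proof -
  let ?N = "real (card (F2 n))"
  have finA: "finite A" using A(1) finite_F2 by (rule finite_subset)
  have finB: "finite B" using B(1) finite_F2 by (rule finite_subset)
  have cA: "real (card A) > 0" using finA A by (simp add: card_gt_0_iff)
  have cB: "real (card B) > 0" using finB B by (simp add: card_gt_0_iff)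
  have FF: "fourier n F y = bias n X y ^ l * (bias n B y * (bias n A y * fourier n g y))" for y
    unfolding F_def by (simp add: fourier_avg_iterate X fourier_avg A B)
  have gy: "\<bar>fourier n g y\<bar> \<le> 2 * ?N" for y
  proof -
    have "\<bar>fourier n g y\<bar> \<le> (\<Sum>x\<in>F2 n. \<bar>g x * chi n y x\<bar>)"
      unfolding fourier_def by (rule sum_abs)
    also have "\<dots> \<le> (\<Sum>x\<in>F2 n. 2)" using g by (intro sum_mono) (simp add: abs_mult)
    finally show ?thesis by simp
  qed
  have coeff: "\<bar>fourier n F y * (chi n y v - 1)\<bar>
      \<le> 2 * ?N / 2 ^ l * ((bias n A y)\<^sup>2 + (bias n B y)\<^sup>2)" if y: "y \<in> F2 n" for y
  proof (cases "\<bar>bias n X y\<bar> \<ge> 1 / 2 \<or> fourier n g y = 0")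
    case True
    then have "fourier n F y * (chi n y v - 1) = 0" using triv y by (auto simp: FF)
    then have "\<bar>fourier n F y * (chi n y v - 1)\<bar> = 0" by (simp only: abs_zero)
    also have "0 \<le> 2 * ?N / 2 ^ l * ((bias n A y)\<^sup>2 + (bias n B y)\<^sup>2)" by simp
    finally show ?thesis .
  next
    case False
    then have "\<bar>bias n X y\<bar> \<le> 1 / 2" by simp
    then have "\<bar>bias n X y\<bar> ^ l \<le> (1 / 2) ^ l" by (intro power_mono) auto
    then have X': "\<bar>bias n X y ^ l\<bar> \<le> 1 / 2 ^ l" by (simp add: power_abs power_divide)
    \<comment> \<open>A pointwise substitute for Cauchy-Schwarz that leaves sums of squares for
      \<open>bias_parseval\<close>.\<close>
    have AB: "\<bar>bias n B y\<bar> * \<bar>bias n A y\<bar> \<le> ((bias n A y)\<^sup>2 + (bias n B y)\<^sup>2) / 2"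
      using sum_squares_bound [of "\<bar>bias n B y\<bar>" "\<bar>bias n A y\<bar>"] by simp
    have "\<bar>chi n y v - 1\<bar> \<le> 2" using chi_cases [of n y v] by auto
    then have "\<bar>fourier n F y\<bar> * \<bar>chi n y v - 1\<bar> \<le> \<bar>fourier n F y\<bar> * 2"
      by (intro mult_left_mono) auto
    then have "\<bar>fourier n F y * (chi n y v - 1)\<bar>
        \<le> \<bar>bias n X y ^ l\<bar> * ((\<bar>bias n B y\<bar> * \<bar>bias n A y\<bar>) * \<bar>fourier n g y\<bar>) * 2"
      unfolding FF abs_mult by (simp only: mult_ac)
    also have "\<dots> \<le> 1 / 2 ^ l * ((((bias n A y)\<^sup>2 + (bias n B y)\<^sup>2) / 2) * (2 * ?N)) * 2"
      using X' AB gy by (intro mult_mono mult_nonneg_nonneg) auto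
    finally show ?thesis by (simp add: mult_ac)
  qed
  have "?N * (F v - F 0) = (\<Sum>y\<in>F2 n. fourier n F y * (chi n y v - 1))"
    using fourier_inversion [OF v, of F] fourier_inversion [of 0 n F]
    by (simp add: right_diff_distrib sum_subtractf)
  then have "\<bar>?N * (F v - F 0)\<bar> \<le> (\<Sum>y\<in>F2 n. \<bar>fourier n F y * (chi n y v - 1)\<bar>)"
    by (metis sum_abs)
  also have "\<dots> \<le> (\<Sum>y\<in>F2 n. 2 * ?N / 2 ^ l * ((bias n A y)\<^sup>2 + (bias n B y)\<^sup>2))"
    by (intro sum_mono coeff)
  also have "\<dots> = 2 * ?N / 2 ^ l * (?N / real (card A) + ?N / real (card B))"
    unfolding sum_distrib_left [symmetric] sum.distrib bias_parseval [OF A] bias_parseval [OF B]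
    by (rule refl)
  also have "\<dots> \<le> 2 * ?N / 2 ^ l * (K + K)"
    using KA KB cA cB by (intro mult_left_mono add_mono) (auto simp: pos_divide_le_eq)
  also have "\<dots> = ?N * (4 * K / 2 ^ l)" by simp
  finally have "?N * \<bar>F v - F 0\<bar> \<le> ?N * (4 * K / 2 ^ l)" by (simp only: abs_mult abs_of_nat)
  then show ?thesis by (rule mult_left_le_imp_le) simp
qed

text \<open>Repeated averaging over \<open>X\<close> makes \<open>H\<close> nearly constant on the
  annihilator \<open>V\<close> of the large spectrum, while almost periodicity keeps the averaged
  function close to \<open>H\<close>; so \<open>avg V H 0\<close> is close to \<open>H 0\<close>.
  The clause on periods of \<open>g\<close> serves the lifting, where it puts the avoiding subspace
  inside \<open>V\<close>, and the range [0, 2] makes room for the shifted test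
  \<open>f + 1\<close>.\<close>

lemma dense_sumset_coset:
  fixes l :: nat
  assumes A: "A \<subseteq> F2 n" "A \<noteq> {}" and B: "B \<subseteq> F2 n" "B \<noteq> {}"
    and g: "\<And>x. 0 \<le> g x \<and> g x \<le> 2"
    and r: "real (card (A + B)) \<le> r * real (card A)"
    and e: "0 < e" "e \<le> 1" and q: "q > 0"
    and samples: "4 * real (card (F2 n)) * exp (- real q * e\<^sup>2 / 16) \<le> e * real (card B)"
    and KA: "real (card (F2 n)) \<le> K * real (card A)" and KB: "real (card (F2 n)) \<le> K * real (card B)"
  obtains V d s where "f2.subspace V" "V \<subseteq> F2 n" "card V * 2 ^ d = card (F2 n)"
    "real d \<le> 16 * ln (2 * r ^ q * K)"
    "\<And>w. w \<in> F2 n \<Longrightarrow> (\<And>x. g (w + x) = g x) \<Longrightarrow> w \<in> V"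
    "s \<in> A + B" "avg V g s \<ge> avg B (avg A g) 0 - 4 * K / 2 ^ l - 12 * real l * e"
proof -
  let ?N = "real (card (F2 n))"
  have finA: "finite A" using A(1) finite_F2 by (rule finite_subset)
  have finB: "finite B" using B(1) finite_F2 by (rule finite_subset)
  define H where "H = avg B (avg A g)"
  obtain X where X: "X \<subseteq> F2 n" "X \<noteq> {}" and BX: "real (card B) \<le> 2 * r ^ q * real (card X)"
    and ap: "\<And>x s. x \<in> X \<Longrightarrow> s \<in> F2 n \<Longrightarrow> \<bar>H (x + s) - H s\<bar> \<le> 6 * e"
    by (rule croot_sisask [where g = g, OF A B g r e q samples, folded H_def]) blast
  have finX: "finite X" using X(1) finite_F2 by (rule finite_subset)
  have cX: "real (card X) > 0" using finX X by (simp add: card_gt_0_iff)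
  have cB: "real (card B) > 0" using finB B by (simp add: card_gt_0_iff)
  \<comment> \<open>Leaving out the frequencies absent from \<open>g\<close> keeps all periods of
    \<open>g\<close> in the annihilator: a period \<open>w\<close> forces
    \<open>chi n y w = 1\<close> wherever \<open>fourier n g y\<close> is non-zero.\<close>
  define Spec where "Spec = {y \<in> F2 n. \<bar>bias n X y\<bar> \<ge> 1 / 2 \<and> fourier n g y \<noteq> 0}"
  obtain S where S: "S \<subseteq> Spec" "f2.independent S" "Spec \<subseteq> f2.span S"
    using f2.maximal_independent_subset by blast
  have SF: "S \<subseteq> F2 n" using S by (auto simp: Spec_def)
  define V where "V = {v \<in> F2 n. \<forall>y\<in>S. chi n y v = 1}"
  note V = chi_annihilator [OF SF S(2), folded V_def]
  have VF: "V \<subseteq> F2 n" by (auto simp: V_def)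
  have finV: "finite V" using VF finite_F2 by (rule finite_subset)
  have V0: "V \<noteq> {}" using V(1) f2.subspace_0 by blast
  have "real (card S) \<le> 16 * ln (?N / real (card X))"
    using S by (intro chang [OF X SF S(2)]) (auto simp: Spec_def)
  also have "\<dots> \<le> 16 * ln (2 * r ^ q * K)"
  proof -
    have K0: "K \<ge> 0"
      using order.trans [OF of_nat_0_le_iff KB] cB by (simp add: zero_le_mult_iff)
    have "?N \<le> K * (2 * r ^ q * real (card X))"
      using KB mult_left_mono [OF BX K0] by linarith
    then have "?N / real (card X) \<le> 2 * r ^ q * K"
      using cX by (simp add: pos_divide_le_eq mult_ac)
    moreover have "0 < ?N / real (card X)" using cX by simp
    ultimately have "ln (?N / real (card X)) \<le> ln (2 * r ^ q * K)"
      by (intro iffD2 [OF ln_le_cancel_iff]) linarith+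
    then show ?thesis by simp
  qed
  finally have dS: "real (card S) \<le> 16 * ln (2 * r ^ q * K)" .
  have per: "w \<in> V" if w: "w \<in> F2 n" "\<And>x. g (w + x) = g x" for w
  proof -
    have "chi n y w = 1" if y: "y \<in> S" for y
    proof -
      have "fourier n g y = (\<Sum>x\<in>F2 n. g (w + x) * chi n y (w + x))"
        unfolding fourier_def by (rule sum_F2_shift [OF w(1), symmetric])
      also have "\<dots> = chi n y w * fourier n g y"
        by (simp add: w(2) chi_add fourier_def sum_distrib_left mult_ac)
      finally show ?thesis using y S(1) by (auto simp: Spec_def)
    qed
    then show ?thesis using w by (simp add: V_def)
  qed
  define F where "F = (avg X ^^ l) H"
  have FH: "\<bar>F z - H z\<bar> \<le> real l * (6 * e)" if "z \<in> F2 n" for z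
    unfolding F_def by (rule avg_iterate_close [OF X ap that])
  have Fv: "\<bar>F v - F 0\<bar> \<le> 4 * K / 2 ^ l" if "v \<in> V" for v
    unfolding F_def H_def
  proof (rule fourier_small_shift [OF A B X(1) g KA KB])
    show "v \<in> F2 n" using that VF by auto
    fix y assume "y \<in> F2 n" "\<bar>bias n X y\<bar> \<ge> 1 / 2" "fourier n g y \<noteq> 0"
    then have "y \<in> f2.span S" using S(3) by (auto simp: Spec_def)
    then show "chi n y v = 1" using V(3) that by blast
  qed
  \<comment> \<open>The 12 is 2 * 6: the error \<open>6 * e\<close> per round is paid once at
    \<open>v\<close> and once at 0.\<close>
  have Hv: "\<bar>H (v + 0) - H 0\<bar> \<le> 4 * K / 2 ^ l + 12 * real l * e" if "v \<in> V" for v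
  proof -
    have "v \<in> F2 n" using that VF by auto
    from Fv [OF that] FH [OF this] FH [OF zero_in_F2] show ?thesis by simp
  qed
  have "\<bar>avg V H 0 - H 0\<bar> \<le> 4 * K / 2 ^ l + 12 * real l * e"
    by (rule avg_close [OF _ finV V0]) (rule Hv)
  \<comment> \<open>With the average over \<open>V\<close> moved innermost, the outer averages run
    over \<open>B\<close> and \<open>A\<close>, so some \<open>a + b\<close> does at least as well
    as the average.\<close>
  moreover have "avg V H 0 = avg B (avg A (avg V g)) 0"
    unfolding H_def by (simp add: avg_commute [of V])
  moreover obtain b where b: "b \<in> B" "avg B (avg A (avg V g)) 0 \<le> avg A (avg V g) (b + 0)"
    by (rule avg_le_some [OF finB B(2)])
  moreover obtain a where a: "a \<in> A" "avg A (avg V g) (b + 0) \<le> avg V g (a + (b + 0))"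
    by (rule avg_le_some [OF finA A(2)])
  ultimately have "avg V g (a + b) \<ge> H 0 - 4 * K / 2 ^ l - 12 * real l * e"
    by simp
  moreover have "a + b \<in> A + B" using a b by (intro set_plus_intro)
  ultimately show thesis
    using that [of V "card S" "a + b"] V VF dS per unfolding H_def by blast
qed

subsection \<open>Petridis' inequality\<close>

text \<open>When \<open>c\<close> joins \<open>C\<close>, let \<open>Z\<close> be the points of
  \<open>X\<close> whose translates of \<open>B\<close> by \<open>c\<close> are already covered. The
  left sumset gains at most \<open>card (X + B) - card (Z + B)\<close> points, while
  \<open>X + C\<close> gains at least \<open>card X - card Z\<close>; minimality of the ratio for
  \<open>X\<close> compares the two gains. The hypothesis \<open>min\<close> is that minimality with
  denominators cleared, so that \<open>Z\<close> may be empty.\<close>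

lemma petridis_minimal:
  fixes X B C :: "'a::ab_group_add set"
  assumes fin: "finite X" "finite B" "finite C"
    and min: "\<And>Z. Z \<subseteq> X \<Longrightarrow> card (X + B) * card Z \<le> card (Z + B) * card X"
  shows "card (X + B + C) * card X \<le> card (X + B) * card (X + C)"
  using fin(3)
proof (induction C rule: finite_induct)
  case empty
  then show ?case by (simp add: set_plus_def)
next
  case (insert c C)
  define Z where "Z = {x \<in> X. \<forall>b\<in>B. x + b + c \<in> X + B + C}"
  have ZX: "Z \<subseteq> X" by (auto simp: Z_def)
  have fin': "finite (X + B)" "finite (X + C)" "finite (X + B + C)" "finite Z" "finite (Z + B)"
    using fin insert.hyps ZX by (auto intro!: finite_set_plus intro: finite_subset)
  have ZB: "Z + B \<subseteq> X + B" using ZX by (intro set_plus_mono2) auto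
  have "X + B + insert c C \<subseteq> (X + B + C) \<union> (\<lambda>y. y + c) ` ((X + B) - (Z + B))"
  proof
    fix u assume "u \<in> X + B + insert c C"
    then obtain x b c' where u: "u = x + b + c'" "x \<in> X" "b \<in> B" "c' \<in> insert c C"
      by (auto elim!: set_plus_elim)
    show "u \<in> (X + B + C) \<union> (\<lambda>y. y + c) ` ((X + B) - (Z + B))"
    proof (cases "c' \<in> C \<or> x + b \<in> Z + B")
      case True
      then show ?thesis
      proof
        assume "c' \<in> C"
        then show ?thesis using u by (auto intro!: set_plus_intro)
      next
        assume "x + b \<in> Z + B"
        then obtain x' b' where "x + b = x' + b'" "x' \<in> Z" "b' \<in> B" by (auto elim: set_plus_elim)
        then have "x + b + c \<in> X + B + C" by (auto simp: Z_def)
        moreover have "u \<in> X + B + C" if "c' \<in> C" using that u by (auto intro!: set_plus_intro)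
        ultimately show ?thesis using u by auto
      qed
    next
      case False
      then show ?thesis using u by (auto intro: set_plus_intro)
    qed
  qed
  then have "card (X + B + insert c C)
      \<le> card ((X + B + C) \<union> (\<lambda>y. y + c) ` ((X + B) - (Z + B)))"
    using fin' by (intro card_mono) auto
  also have "\<dots> \<le> card (X + B + C) + card ((X + B) - (Z + B))"
    using fin' by (meson add_left_mono card_Un_le card_image_le finite_Diff order.trans)
  finally have 1: "card (X + B + insert c C) + card (Z + B) \<le> card (X + B + C) + card (X + B)"
    using fin' ZB card_mono [OF _ ZB] by (simp add: card_Diff_subset)
  have "(X + C) \<union> (\<lambda>y. y + c) ` (X - Z) \<subseteq> X + insert c C"
    by (auto intro: set_plus_intro elim!: set_plus_elim)
  then have "card ((X + C) \<union> (\<lambda>y. y + c) ` (X - Z)) \<le> card (X + insert c C)"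
    using fin insert.hyps by (intro card_mono finite_set_plus) auto
  moreover have "(X + C) \<inter> (\<lambda>y. y + c) ` (X - Z) = {}"
  proof (rule ccontr)
    assume "(X + C) \<inter> (\<lambda>y. y + c) ` (X - Z) \<noteq> {}"
    then obtain x where x: "x \<in> X" "x \<notin> Z" "x + c \<in> X + C" by auto
    obtain x' c' where x': "x + c = x' + c'" "x' \<in> X" "c' \<in> C"
      using x(3) by (auto elim: set_plus_elim)
    have "x + b + c \<in> X + B + C" if "b \<in> B" for b
    proof -
      have "x + b + c = x' + b + c'" using x' by (simp add: algebra_simps)
      moreover have "x' + b + c' \<in> X + B + C" using x' that by (intro set_plus_intro)
      ultimately show ?thesis by metis
    qed
    then show False using x by (auto simp: Z_def)
  qed
  then have "card ((X + C) \<union> (\<lambda>y. y + c) ` (X - Z)) = card (X + C) + card (X - Z)"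
    using fin fin' by (subst card_Un_disjoint) (auto simp: card_image)
  moreover have "card (X - Z) + card Z = card X"
    using fin ZX fin' card_mono [OF fin(1) ZX] by (simp add: card_Diff_subset)
  ultimately have 2: "card (X + C) + card X \<le> card (X + insert c C) + card Z"
    by linarith
  have "card (X + B + insert c C) * card X + card (X + B) * card Z
      \<le> (card (X + B + insert c C) + card (Z + B)) * card X"
    using min [OF ZX] by (simp add: distrib_right)
  also have "\<dots> \<le> (card (X + B + C) + card (X + B)) * card X"
    using 1 by (rule mult_right_mono) simp
  also have "\<dots> \<le> card (X + B) * (card (X + C) + card X)"
    using insert.IH by (simp add: distrib_left distrib_right)
  also have "\<dots> \<le> card (X + B) * (card (X + insert c C) + card Z)"
    using 2 by (intro mult_left_mono) auto
  finally show ?case by (simp add: distrib_left)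
qed

lemma petridis:
  fixes A B :: "'a::ab_group_add set"
  assumes fin: "finite A" "finite B" and ne: "A \<noteq> {}"
    and r: "real (card (A + B)) \<le> r * real (card A)"
  obtains X where "X \<subseteq> A" "X \<noteq> {}"
    "\<And>C. finite C \<Longrightarrow> real (card (X + B + C)) \<le> r * real (card (X + C))"
proof -
  let ?\<rho> = "\<lambda>Z. real (card (Z + B)) / real (card Z)"
  let ?S = "{Z. Z \<subseteq> A \<and> Z \<noteq> {}}"
  have finS: "finite ?S" using fin by simp
  have neS: "?S \<noteq> {}" using ne by auto
  define X where "X = arg_min_on ?\<rho> ?S"
  have X: "X \<in> ?S" unfolding X_def by (rule arg_min_if_finite(1) [OF finS neS])
  have minX: "?\<rho> X \<le> ?\<rho> Z" if "Z \<in> ?S" for Z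
    unfolding X_def by (rule arg_min_least [OF finS neS that])
  have finZ: "finite Z" if "Z \<subseteq> A" for Z using that fin(1) by (rule finite_subset)
  have pos: "real (card Z) > 0" if "Z \<in> ?S" for Z
    using that finZ by (auto simp: card_gt_0_iff)
  have "?\<rho> X \<le> ?\<rho> A" using minX ne by simp
  also have "\<dots> \<le> r" using r pos [of A] ne by (simp add: pos_divide_le_eq)
  finally have \<rho>: "?\<rho> X \<le> r" .
  have "real (card (X + B + C)) \<le> r * real (card (X + C))" if C: "finite C" for C
  proof -
    have "card (X + B + C) * card X \<le> card (X + B) * card (X + C)"
    proof (rule petridis_minimal)
      show "finite X" "finite B" "finite C" using X finZ fin C by auto
      fix Z assume Z: "Z \<subseteq> X"
      show "card (X + B) * card Z \<le> card (Z + B) * card X"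
      proof (cases "Z = {}")
        case False
        then have ZS: "Z \<in> ?S" using Z X by auto
        have "real (card (X + B)) * real (card Z) \<le> real (card (Z + B)) * real (card X)"
          using minX [OF ZS] pos [OF ZS] pos [OF X]
          by (simp add: divide_le_eq pos_le_divide_eq field_simps)
        then show ?thesis by (metis of_nat_le_iff of_nat_mult)
      qed simp
    qed
    then have "real (card (X + B + C)) * real (card X) \<le> real (card (X + B)) * real (card (X + C))"
      by (metis of_nat_le_iff of_nat_mult)
    then have "real (card (X + B + C)) \<le> ?\<rho> X * real (card (X + C))"
      using pos [OF X] by (simp add: pos_le_divide_eq)
    also have "\<dots> \<le> r * real (card (X + C))" using \<rho> by (intro mult_right_mono) auto
    finally show ?thesis .
  qed
  then show thesis using that X by auto
qed

text \<open>With extremal subsets \<open>X\<close> of \<open>A\<close> and \<open>Y\<close> of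
  \<open>B\<close>, a copy of \<open>D\<close> splits into a \<open>B\<close> attached to
  \<open>X\<close> and an \<open>A\<close> attached to \<open>Y\<close>, each costing a factor
  \<open>r\<close>. Six copies cost \<open>r ^ 12\<close>, and the remaining \<open>X + Y\<close>,
  contained in \<open>A + B\<close>, costs one more \<open>r\<close>.\<close>

lemma card_sixfold_sumset:
  fixes A B :: "'a::ab_group_add set"
  assumes fin: "finite A" "finite B" and ne: "A \<noteq> {}" and eq: "card A = card B"
    and r: "real (card (A + B)) \<le> r * real (card A)" "r \<ge> 0"
  defines "D \<equiv> A + B"
  shows "real (card (D + D + (D + D) + (D + D))) \<le> r ^ 13 * real (card A)"
proof -
  have neB: "B \<noteq> {}" using eq ne fin by auto
  obtain X where X: "X \<subseteq> A" "X \<noteq> {}"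
    and XC: "\<And>C. finite C \<Longrightarrow> real (card (X + B + C)) \<le> r * real (card (X + C))"
    using petridis [OF fin ne r(1)] by blast
  have r': "real (card (B + A)) \<le> r * real (card B)" using r eq by (simp add: add.commute)
  obtain Y where Y: "Y \<subseteq> B" "Y \<noteq> {}"
    and YC: "\<And>C. finite C \<Longrightarrow> real (card (Y + A + C)) \<le> r * real (card (Y + C))"
    using petridis [OF fin(2,1) neB r'] by blast
  have finXY: "finite X" "finite Y" using X Y fin finite_subset by blast+
  have finD: "finite D" unfolding D_def using fin by (rule finite_set_plus)
  have step: "real (card (D + C + (X + Y))) \<le> r\<^sup>2 * real (card (C + (X + Y)))" if C: "finite C" for C
  proof -
    have "D + C + (X + Y) = X + B + (Y + A + C)" unfolding D_def by (simp add: add_ac)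
    then have "real (card (D + C + (X + Y))) \<le> r * real (card (X + (Y + A + C)))"
      using XC [of "Y + A + C"] finXY fin C by (simp add: finite_set_plus)
    also have "X + (Y + A + C) = Y + A + (X + C)" by (simp add: add_ac)
    also have "r * real (card (Y + A + (X + C))) \<le> r * (r * real (card (Y + (X + C))))"
      using YC [of "X + C"] finXY C r by (intro mult_left_mono) (auto simp: finite_set_plus)
    also have "Y + (X + C) = C + (X + Y)" by (simp add: add_ac)
    finally show ?thesis by (simp add: power2_eq_square)
  qed
  have step': "real (card (D + C + (X + Y))) \<le> r\<^sup>2 * u"
    if "finite C" "real (card (C + (X + Y))) \<le> u" for C u
    using step [OF that(1)] mult_left_mono [OF that(2), of "r\<^sup>2"] by simp
  have "real (card (X + Y)) \<le> real (card (A + B))"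
    using X Y fin by (intro of_nat_mono card_mono finite_set_plus set_plus_mono2) auto
  also have "\<dots> \<le> r * real (card A)" by (rule r)
  finally have "real (card (0 + (X + Y))) \<le> r * real (card A)" by simp
  then have "real (card (D + (D + (D + (D + (D + (D + 0))))) + (X + Y)))
      \<le> r\<^sup>2 * (r\<^sup>2 * (r\<^sup>2 * (r\<^sup>2 * (r\<^sup>2 * (r\<^sup>2 * (r * real (card A)))))))"
    using finD by (intro step') (auto intro!: finite_set_plus simp: set_zero)
  also have "\<dots> = r ^ 13 * real (card A)"
    by (simp add: power_numeral_reduce)
  also have "D + (D + (D + (D + (D + (D + 0))))) + (X + Y) = D + D + (D + D) + (D + D) + (X + Y)"
    by (simp add: add_ac)
  finally have le: "real (card (D + D + (D + D) + (D + D) + (X + Y))) \<le> r ^ 13 * real (card A)" .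
  obtain x y where xy: "x \<in> X" "y \<in> Y" using X Y by blast
  \<comment> \<open>A single translate discards the auxiliary summand \<open>X + Y\<close>.\<close>
  have "(\<lambda>t. t + (x + y)) ` (D + D + (D + D) + (D + D)) \<subseteq> D + D + (D + D) + (D + D) + (X + Y)"
    using xy by (auto intro!: set_plus_intro)
  then have "card ((\<lambda>t. t + (x + y)) ` (D + D + (D + D) + (D + D)))
      \<le> card (D + D + (D + D) + (D + D) + (X + Y))"
    using finD finXY by (intro card_mono finite_set_plus) auto
  then have "card (D + D + (D + D) + (D + D)) \<le> card (D + D + (D + D) + (D + D) + (X + Y))"
    by (simp add: card_image)
  then show ?thesis using le by linarith
qed

subsection \<open>Lifting from a dense model\<close>

text \<open>By maximality, adjoining any \<open>x\<close> outside \<open>W\<close> creates a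
  non-zero element of \<open>T\<close>, which must lie in \<open>x + W\<close>. Hence
  \<open>T + W\<close> is the whole space.\<close>

lemma maximal_avoiding_subspace:
  assumes T: "T \<subseteq> F2 n" "0 \<in> T"
  obtains W where "f2.subspace W" "W \<subseteq> F2 n" "W \<inter> T = {0}" "card (F2 n) \<le> card T * card W"
proof -
  let ?S = "{W. f2.subspace W \<and> W \<subseteq> F2 n \<and> W \<inter> T = {0}}"
  have "?S \<subseteq> Pow (F2 n)" by auto
  then have fin: "finite ?S" by (rule finite_subset) simp
  have "{0} \<in> ?S" using T by (auto intro: f2.subspace_single_0)
  then have "?S \<noteq> {}" by blast
  then obtain W where W: "W \<in> ?S" and maxW: "\<And>U. U \<in> ?S \<Longrightarrow> W \<subseteq> U \<Longrightarrow> W = U"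
    using finite_has_maximal [OF fin] by auto
  have W0: "0 \<in> W" using W f2.subspace_0 by blast
  have Wadd: "x + y \<in> W" if "x \<in> W" "y \<in> W" for x y
    using W that f2.subspace_add by blast
  have "x \<in> T + W" if x: "x \<in> F2 n" for x
  proof (cases "x \<in> W")
    case True
    then show ?thesis using T(2) by (metis add_0 set_plus_intro)
  next
    case False
    let ?U = "W \<union> (+) x ` W"
    have "f2.subspace ?U"
    proof (rule f2_subspaceI)
      show "0 \<in> ?U" using W0 by simp
      fix u v assume u: "u \<in> ?U" and v: "v \<in> ?U"
      have xx: "x + a + b = x + (a + b)" "a + (x + b) = x + (a + b)" "x + a + (x + b) = a + b" for a b
        by (auto simp: add_ac)
      show "u + v \<in> ?U" using u v Wadd by (auto simp: xx)
    qed
    moreover have "?U \<subseteq> F2 n" using W x by (auto intro!: F2_add)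
    moreover have "x \<in> ?U" using W0 by (metis UnI2 add_0_right image_eqI)
    then have "W \<noteq> ?U" using False by blast
    ultimately have "?U \<inter> T \<noteq> {0}" using maxW [of ?U] by blast
    moreover have "0 \<in> ?U \<inter> T" using W0 T by simp
    ultimately obtain t where t: "t \<in> ?U" "t \<in> T" "t \<noteq> 0" by blast
    have "t \<notin> W" using t W by blast
    then obtain w where "w \<in> W" "t = x + w" using t by blast
    then have "x = t + w" by (simp add: add.assoc)
    then show ?thesis using t(2) \<open>w \<in> W\<close> by (metis set_plus_intro)
  qed
  then have sub: "F2 n \<subseteq> (\<lambda>(t, w). t + w) ` (T \<times> W)" by (force elim: set_plus_elim)
  have finT: "finite T" "finite W" using T(1) W finite_F2 finite_subset by blast+
  have "card (F2 n) \<le> card ((\<lambda>(t, w). t + w) ` (T \<times> W))"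
    using sub finT by (intro card_mono) auto
  also have "\<dots> \<le> card (T \<times> W)" using finT by (intro card_image_le) auto
  finally have "card (F2 n) \<le> card T * card W" by (simp add: card_cartesian_product)
  then show thesis using that W by blast
qed

context
  fixes A W :: "(nat \<Rightarrow> bit) set"
  assumes fin: "finite A" "finite W" and W: "f2.subspace W"
    and indep: "\<And>a a'. a \<in> A \<Longrightarrow> a' \<in> A \<Longrightarrow> a + a' \<in> W \<Longrightarrow> a = a'"
begin

text \<open>By \<open>indep\<close>, the elements of \<open>A\<close> lie in distinct cosets of
  \<open>W\<close>, so for counting and averaging \<open>A + W\<close> behaves like the product of
  \<open>A\<close> and \<open>W\<close>.\<close>

lemma direct_sum_inj: "inj_on (\<lambda>(a, w). a + w) (A \<times> W)"
proof (rule inj_onI, clarify)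
  fix a w a' w' assume *: "a \<in> A" "w \<in> W" "a' \<in> A" "w' \<in> W" "a + w = a' + w'"
  have "w + w' = a + (a + w) + w'" by simp
  also have "\<dots> = a + a' + (w' + w')" unfolding *(5) by (simp only: add.assoc)
  finally have "a + a' \<in> W" using f2.subspace_add [OF W *(2,4)] by simp
  then have "a = a'" using indep * by blast
  then show "a = a' \<and> w = w'" using * by simp
qed

lemma direct_sum_eq: "A + W = (\<lambda>(a, w). a + w) ` (A \<times> W)"
  by (force elim: set_plus_elim intro: set_plus_intro)

lemma card_direct_sum: "card (A + W) = card A * card W"
  unfolding direct_sum_eq card_image [OF direct_sum_inj] by (rule card_cartesian_product)

lemma avg_direct_sum:
  assumes "\<And>w x. w \<in> W \<Longrightarrow> g (w + x) = g x"
  shows "avg (A + W) g z = avg A g z"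
proof -
  have W0: "card W \<noteq> 0" using fin W f2.subspace_0 by auto
  have "(\<Sum>x\<in>A + W. g (x + z)) = (\<Sum>(a, w)\<in>A \<times> W. g (a + w + z))"
    unfolding direct_sum_eq
    by (subst sum.reindex [OF direct_sum_inj]) (simp add: case_prod_unfold)
  also have "\<dots> = (\<Sum>(a, w)\<in>A \<times> W. g (a + z))"
  proof (rule sum.cong [OF refl], clarify)
    fix a w assume "w \<in> W"
    have "a + w + z = w + (a + z)" by (simp add: add_ac)
    then show "g (a + w + z) = g (a + z)" using assms [OF \<open>w \<in> W\<close>] by metis
  qed
  also have "\<dots> = real (card W) * (\<Sum>a\<in>A. g (a + z))"
    by (simp add: sum.cartesian_product [symmetric] sum_distrib_left)
  finally show ?thesis using W0 by (simp add: avg_def card_direct_sum)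
qed

end

text \<open>Triviality of \<open>W \<inter> T\<close> is used at three depths: within
  \<open>D + D\<close> it makes \<open>A\<close>, \<open>B\<close> and \<open>D\<close> inject
  modulo \<open>W\<close>; within four copies of \<open>D\<close> it makes the lifted subspace
  inject and identifies its translate with points of \<open>D\<close>; within six it gives closure
  under addition. The assumption \<open>large\<close> pushes the mean of the shifted function
  strictly above 1.\<close>

lemma sumset_coset:
  fixes l :: nat
  assumes A: "A \<subseteq> F2 n" "A \<noteq> {}" and B: "B \<subseteq> F2 n" and AB: "card A = card B"
    and f: "\<And>x. 0 \<le> f x \<and> f x \<le> 1"
    and r: "real (card (A + B)) \<le> r * real (card A)" "r \<ge> 1"
    and e: "0 < e" "e \<le> 1" and q: "q > 0"
    and samples: "4 * r ^ 13 * exp (- real q * e\<^sup>2 / 16) \<le> e"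
    and \<delta>: "\<delta> = 4 * r ^ 13 / 2 ^ l + 12 * real l * e"
    and large: "\<delta> < avg B (avg A f) 0"
  obtains V d s where "f2.subspace V" "V \<subseteq> F2 n" "card A \<le> card V * 2 ^ d"
    "real d \<le> 16 * ln (2 * r ^ q * r ^ 13)" "s \<in> F2 n"
    "avg V f s \<ge> avg B (avg A f) 0 - \<delta>"
proof -
  have finA: "finite A" using A(1) finite_F2 by (rule finite_subset)
  have finB: "finite B" using B finite_F2 by (rule finite_subset)
  have B0: "B \<noteq> {}" using AB A(2) finA by auto
  define D where "D = A + B"
  define D2 where "D2 = D + D"
  define T where "T = D2 + D2 + D2"
  have finD: "finite D" unfolding D_def using finA finB by (rule finite_set_plus)
  have plusF: "P + Q \<subseteq> F2 n" if "P \<subseteq> F2 n" "Q \<subseteq> F2 n" for P Q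
    using that by (auto elim!: set_plus_elim intro!: F2_add)
  have DF: "D \<subseteq> F2 n" unfolding D_def using A B by (intro plusF)
  have D2F: "D2 \<subseteq> F2 n" unfolding D2_def using DF by (intro plusF)
  have TF: "T \<subseteq> F2 n" unfolding T_def using D2F by (intro plusF)
  have "D \<noteq> {}" using A(2) B0 by (auto simp: D_def set_plus_def)
  then obtain t where "t \<in> D" by blast
  then have "t + t \<in> D2" unfolding D2_def by (intro set_plus_intro)
  then have D20: "0 \<in> D2" by simp
  have D4T: "x + y \<in> T" if "x \<in> D2" "y \<in> D2" for x y
    using set_plus_intro [OF set_plus_intro [OF that] D20] by (simp add: T_def)
  have D2T: "x \<in> T" if "x \<in> D2" for x
    using D4T [OF that D20] by simp
  have cT: "real (card T) \<le> r ^ 13 * real (card A)"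
    unfolding T_def D2_def D_def
    by (rule card_sixfold_sumset) (use finA finB A AB r in auto)
  have "0 \<in> T" using D2T D20 by blast
  then obtain W where W: "f2.subspace W" "W \<subseteq> F2 n" "W \<inter> T = {0}"
    and NW: "card (F2 n) \<le> card T * card W"
    by (rule maximal_avoiding_subspace [OF TF])
  have finW: "finite W" using W(2) finite_F2 by (rule finite_subset)
  have W0: "0 \<in> W" using W(1) f2.subspace_0 by blast
  have Wadd: "x + y \<in> W" if "x \<in> W" "y \<in> W" for x y
    using W that f2.subspace_add by blast
  have WT: "x = 0" if "x \<in> W" "x \<in> T" for x using W(3) that by blast
  have WW: "W + W = W"
  proof (intro equalityI subsetI)
    fix x assume "x \<in> W + W"
    then show "x \<in> W" using Wadd by (auto elim: set_plus_elim)
  next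
    fix x assume "x \<in> W"
    then show "x \<in> W + W" using set_plus_intro [OF W0] by fastforce
  qed
  have indD: "t = t'" if "t \<in> D" "t' \<in> D" "t + t' \<in> W" for t t'
  proof -
    have "t + t' \<in> D2" unfolding D2_def using that by (intro set_plus_intro)
    then show ?thesis using WT [OF that(3)] D2T f2_add_eq_0_iff by blast
  qed
  have indA: "a = a'" if "a \<in> A" "a' \<in> A" "a + a' \<in> W" for a a'
  proof -
    obtain b where b: "b \<in> B" using B0 by blast
    have "(a + b) + (a' + b) = a + a'" by (simp add: add_ac)
    then have "a + b = a' + b" using that b by (intro indD) (auto simp: D_def intro: set_plus_intro)
    then show ?thesis by simp
  qed
  have indB: "b = b'" if "b \<in> B" "b' \<in> B" "b + b' \<in> W" for b b'
  proof -
    obtain a where a: "a \<in> A" using A by blast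
    have "(a + b) + (a + b') = b + b'" by (simp add: add_ac)
    then have "a + b = a + b'" using that a by (intro indD) (auto simp: D_def intro: set_plus_intro)
    then show ?thesis by simp
  qed
  define A' where "A' = A + W"
  define B' where "B' = B + W"
  have cA': "card A' = card A * card W"
    unfolding A'_def using card_direct_sum [OF finA finW W(1)] indA by blast
  have cB': "card B' = card B * card W"
    unfolding B'_def using card_direct_sum [OF finB finW W(1)] indB by blast
  have DW: "A' + B' = D + W"
  proof -
    have "A' + B' = (A + B) + (W + W)" unfolding A'_def B'_def by (simp add: add_ac)
    then show ?thesis by (simp add: WW D_def)
  qed
  have cDW: "card (D + W) = card D * card W"
    using card_direct_sum [OF finD finW W(1)] indD by blast
  \<comment> \<open>At most one summand is non-zero, because \<open>D\<close> meets each coset of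
    \<open>W\<close> at most once. So this is \<open>f + 1\<close> carried from \<open>D\<close> to
    \<open>D + W\<close>, and 0 elsewhere.\<close>
  define g where "g = (\<lambda>x. \<Sum>t\<in>D. if x + t \<in> W then f t + 1 else 0)"
  have g1: "g x = f t + 1" if "t \<in> D" "x + t \<in> W" for x t
  proof -
    have "g x = (\<Sum>t'\<in>D. if t' = t then f t + 1 else 0)"
      unfolding g_def
    proof (rule sum.cong [OF refl])
      fix t' assume t': "t' \<in> D"
      have *: "t' = t" if "x + t' \<in> W"
      proof -
        have "(x + t') + (x + t) \<in> W" by (rule Wadd [OF that \<open>x + t \<in> W\<close>])
        moreover have "(x + t') + (x + t) = t' + t" by (simp add: add_ac)
        ultimately show ?thesis using indD t' \<open>t \<in> D\<close> by metis
      qed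
      show "(if x + t' \<in> W then f t' + 1 else 0) = (if t' = t then f t + 1 else 0)"
      proof (cases "t' = t")
        case True
        then show ?thesis using that(2) by simp
      next
        case False
        then have "x + t' \<notin> W" using * by blast
        then show ?thesis using False by simp
      qed
    qed
    then show ?thesis using finD that by simp
  qed
  have g0: "g x = 0" if "\<And>t. t \<in> D \<Longrightarrow> x + t \<notin> W" for x
    unfolding g_def using that by (intro sum.neutral) auto
  have gb: "0 \<le> g x \<and> g x \<le> 2" for x
  proof (cases "\<exists>t\<in>D. x + t \<in> W")
    case True
    then obtain t where "g x = f t + 1" using g1 by blast
    then show ?thesis using f [of t] by simp
  next
    case False
    then have "g x = 0" using g0 by blast
    then show ?thesis by simp
  qed
  have gW: "g (w + x) = g x" if w: "w \<in> W" for w x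
  proof -
    have "w + x + t \<in> W \<longleftrightarrow> x + t \<in> W" for t
    proof
      assume "w + x + t \<in> W"
      then have "w + (w + x + t) \<in> W" using w Wadd by blast
      then show "x + t \<in> W" by (simp add: add.assoc)
    next
      assume "x + t \<in> W"
      then show "w + x + t \<in> W" using w Wadd by (simp add: add.assoc)
    qed
    then show ?thesis unfolding g_def by simp
  qed
  \<comment> \<open>Every \<open>a + b\<close> lies in \<open>D\<close>, so the shift contributes
    exactly 1 to the mean.\<close>
  have avg1: "avg B' (avg A' g) 0 = avg B (avg A f) 0 + 1"
  proof -
    have "avg A' g = avg A g"
      unfolding A'_def using avg_direct_sum [OF finA finW W(1)] indA gW by blast
    moreover have "avg B' (avg A g) 0 = avg B (avg A g) 0"
      unfolding B'_def
    proof (rule avg_direct_sum [OF finB finW W(1)])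
      fix w x assume w: "w \<in> W"
      have "g (a + (w + x)) = g (a + x)" for a
        using gW [OF w, of "a + x"] by (simp add: add_ac)
      then show "avg A g (w + x) = avg A g x" by (simp add: avg_def)
    qed (use indB in blast)
    moreover have "avg B (avg A g) 0 = avg B (avg A f) 0 + 1"
    proof -
      have "avg A g (b + 0) = avg A f (b + 0) + 1" if "b \<in> B" for b
      proof -
        have "g (a + b) = f (a + b) + 1" if "a \<in> A" for a
          using that \<open>b \<in> B\<close> W0 by (intro g1) (auto simp: D_def intro: set_plus_intro)
        then have "(\<Sum>a\<in>A. g (a + b)) = (\<Sum>a\<in>A. f (a + b)) + real (card A)"
          by (simp add: sum.distrib)
        then show ?thesis using finA A(2) by (simp add: avg_def add_divide_distrib)
      qed
      then have "(\<Sum>b\<in>B. avg A g (b + 0)) = (\<Sum>b\<in>B. avg A f (b + 0)) + real (card B)"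
        by (simp add: sum.distrib)
      then show ?thesis using finB B0 by (simp add: avg_def [of B] add_divide_distrib)
    qed
    ultimately show ?thesis by simp
  qed
  have cW: "real (card W) > 0" using finW W0 by (auto simp: card_gt_0_iff)
  have N: "real (card (F2 n)) \<le> r ^ 13 * real (card A')"
  proof -
    have "real (card (F2 n)) \<le> real (card T) * real (card W)"
      using NW by (metis of_nat_le_iff of_nat_mult)
    also have "\<dots> \<le> r ^ 13 * real (card A) * real (card W)"
      using cT by (intro mult_right_mono) auto
    finally show ?thesis by (simp add: cA' mult_ac)
  qed
  have AB': "card A' = card B'" using cA' cB' AB by simp
  have A'F: "A' \<subseteq> F2 n" unfolding A'_def using A W by (intro plusF)
  have B'F: "B' \<subseteq> F2 n" unfolding B'_def using B W by (intro plusF)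
  have A'0: "A' \<noteq> {}" using A W0 by (auto simp: A'_def set_plus_def)
  have B'0: "B' \<noteq> {}" using B0 W0 by (auto simp: B'_def set_plus_def)
  have r': "real (card (A' + B')) \<le> r * real (card A')"
    unfolding DW cDW cA' using mult_right_mono [OF r(1), of "real (card W)"]
    by (simp add: D_def mult_ac)
  have samples': "4 * real (card (F2 n)) * exp (- real q * e\<^sup>2 / 16) \<le> e * real (card B')"
  proof -
    have "4 * real (card (F2 n)) * exp (- real q * e\<^sup>2 / 16)
        \<le> 4 * (r ^ 13 * real (card A')) * exp (- real q * e\<^sup>2 / 16)"
      using N by (intro mult_right_mono mult_left_mono) auto
    also have "\<dots> = (4 * r ^ 13 * exp (- real q * e\<^sup>2 / 16)) * real (card A')" by simp
    also have "\<dots> \<le> e * real (card A')" using samples by (intro mult_right_mono) auto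
    finally show ?thesis by (simp add: AB')
  qed
  obtain V d s where V: "f2.subspace V" "V \<subseteq> F2 n" and cV: "card V * 2 ^ d = card (F2 n)"
    and d: "real d \<le> 16 * ln (2 * r ^ q * r ^ 13)"
    and per: "\<And>w. w \<in> F2 n \<Longrightarrow> (\<And>x. g (w + x) = g x) \<Longrightarrow> w \<in> V"
    and s: "s \<in> A' + B'"
    and avgV: "avg V g s \<ge> avg B' (avg A' g) 0 - 4 * r ^ 13 / 2 ^ l - 12 * real l * e"
    by (rule dense_sumset_coset [where g = g and l = l and K = "r ^ 13",
          OF A'F A'0 B'F B'0 gb r' e q samples' N N [unfolded AB']]) blast
  have avgV1: "avg V g s \<ge> avg B (avg A f) 0 + 1 - \<delta>"
    using avgV unfolding avg1 \<delta> by simp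
  have Vadd: "x + y \<in> V" if "x \<in> V" "y \<in> V" for x y
    using V that f2.subspace_add by blast
  have finV: "finite V" using V(2) finite_F2 by (rule finite_subset)
  have Vpos: "real (card V) > 0" using V(1) finV f2.subspace_0 by (auto simp: card_gt_0_iff)
  have WV: "W \<subseteq> V" using W(2) per gW by blast
  obtain t1 w1 where s1: "s = t1 + w1" "t1 \<in> D" "w1 \<in> W"
    using s unfolding DW by (auto elim: set_plus_elim)
  define S1 where "S1 = {v \<in> V. v + s \<in> D + W}"
  have S1V: "S1 \<subseteq> V" by (auto simp: S1_def)
  \<comment> \<open>The values \<open>g (v + s)\<close> are at most 2 for \<open>v\<close> in
    \<open>S1\<close> and 0 for the other \<open>v\<close>, so a mean above 1 forces
    \<open>S1\<close> to be more than half of \<open>V\<close>.\<close>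
  have "real (card V) < 2 * real (card S1)"
  proof -
    have "(\<Sum>v\<in>V. g (v + s)) \<le> (\<Sum>v\<in>V. if v \<in> S1 then 2 else 0)"
    proof (rule sum_mono)
      fix v assume v: "v \<in> V"
      show "g (v + s) \<le> (if v \<in> S1 then 2 else 0)"
      proof (cases "v \<in> S1")
        case True
        then show ?thesis using gb [of "v + s"] by simp
      next
        case False
        have "v + s + t \<notin> W" if "t \<in> D" for t
        proof
          assume "v + s + t \<in> W"
          then have "t + (v + s + t) \<in> D + W" using that by (intro set_plus_intro)
          moreover have "t + (v + s + t) = v + s" by (simp add: add_ac)
          ultimately show False using False v by (simp add: S1_def)
        qed
        then show ?thesis using g0 False by simp
      qed
    qed
    also have "\<dots> = 2 * real (card S1)"
      using finV S1V by (simp add: sum.If_cases Int_absorb1)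
    finally have "avg V g s \<le> 2 * real (card S1) / real (card V)"
      using Vpos by (simp add: avg_def divide_right_mono)
    moreover have "avg V g s > 1" using avgV1 large by linarith
    ultimately have "1 < 2 * real (card S1) / real (card V)" by linarith
    then show ?thesis using Vpos by (simp add: less_divide_eq)
  qed
  then have S1half: "card V < 2 * card S1" by linarith
  have VD2: "v \<in> D2 + W" if v: "v \<in> V" for v
  proof -
    \<comment> \<open>Two subsets with more than half of the elements of \<open>V\<close> meet, and
      a common point exhibits \<open>v\<close> as a sum of two elements of
      \<open>D + W\<close>.\<close>
    have "S1 \<inter> (+) v ` S1 \<noteq> {}"
    proof
      assume "S1 \<inter> (+) v ` S1 = {}"
      then have "card (S1 \<union> (+) v ` S1) = card S1 + card ((+) v ` S1)"
        using finV S1V by (intro card_Un_disjoint) (auto intro: finite_subset)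
      also have "\<dots> = 2 * card S1" by (simp add: card_image)
      finally have "2 * card S1 = card (S1 \<union> (+) v ` S1)" by simp
      also have "\<dots> \<le> card V"
        using S1V v Vadd finV by (intro card_mono) auto
      finally show False using S1half by simp
    qed
    then obtain u where u: "u \<in> S1" "v + u \<in> S1" by blast
    have "(u + s) + (v + u + s) \<in> (D + W) + (D + W)"
      using u unfolding S1_def by (intro set_plus_intro [of _ "D + W"]) blast+
    moreover have "(D + W) + (D + W) = D2 + (W + W)" by (simp add: D2_def add_ac)
    moreover have "(u + s) + (v + u + s) = v" by (simp add: add_ac)
    ultimately show ?thesis by (simp add: WW)
  qed
  \<comment> \<open>The lift of \<open>V\<close>: representatives modulo \<open>W\<close> taken in
    \<open>D + D\<close>, which exist by \<open>VD2\<close> and are unique by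
    \<open>indV\<close>.\<close>
  define V0 where "V0 = V \<inter> D2"
  have subV0: "f2.subspace V0"
  proof (rule f2_subspaceI)
    show "0 \<in> V0" using V f2.subspace_0 D20 by (auto simp: V0_def)
    fix x y assume x: "x \<in> V0" and y: "y \<in> V0"
    have "x + y \<in> V" using x y Vadd by (auto simp: V0_def)
    then obtain u w where uw: "x + y = u + w" "u \<in> D2" "w \<in> W"
      by (rule set_plus_elim [OF VD2])
    \<comment> \<open>The defect \<open>w\<close> is a sum of three elements of
      \<open>D + D\<close>, so it lies in \<open>T\<close> as well as in \<open>W\<close> and
      vanishes. All six copies of \<open>D\<close> enter here.\<close>
    have "w = u + (u + w)" by simp
    also have "\<dots> = x + y + u" unfolding uw(1) [symmetric] by (simp only: add_ac)
    finally have "w = x + y + u" .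
    moreover have "x + y + u \<in> T"
      unfolding T_def using x y uw(2) by (intro set_plus_intro) (simp_all add: V0_def)
    ultimately have "w \<in> T" by metis
    then have "w = 0" using WT uw by blast
    then have "x + y \<in> D2" using uw by simp
    then show "x + y \<in> V0" using \<open>x + y \<in> V\<close> by (simp add: V0_def)
  qed
  have finV0: "finite V0" using finV by (simp add: V0_def)
  have indV: "v = v'" if "v \<in> V0" "v' \<in> V0" "v + v' \<in> W" for v v'
    using WT [OF that(3)] D4T that f2_add_eq_0_iff by (auto simp: V0_def)
  have Veq: "V = V0 + W"
  proof (intro equalityI subsetI)
    fix v assume v: "v \<in> V"
    obtain u w where uw: "v = u + w" "u \<in> D2" "w \<in> W"
      by (rule set_plus_elim [OF VD2 [OF v]])
    have "u = v + w" using uw by (simp add: add.assoc)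
    then have "u \<in> V" using Vadd v uw WV by blast
    then show "v \<in> V0 + W" using uw by (auto simp: V0_def intro: set_plus_intro)
  next
    fix v assume "v \<in> V0 + W"
    then show "v \<in> V" using Vadd WV by (auto simp: V0_def elim!: set_plus_elim)
  qed
  have cV0: "card V = card V0 * card W"
    unfolding Veq using card_direct_sum [OF finV0 finW W(1)] indV
    by blast
  have "card A * card W \<le> card V0 * 2 ^ d * card W"
  proof -
    have "card A * card W = card A'" by (simp add: cA')
    also have "\<dots> \<le> card (F2 n)" using A'F by (intro card_mono) auto
    also have "\<dots> = card V0 * card W * 2 ^ d" using cV cV0 by simp
    finally show ?thesis by (simp add: mult_ac)
  qed
  then have size: "card A \<le> card V0 * 2 ^ d" using cW by simp
  have "avg V g s = avg V0 g s"
    unfolding Veq using avg_direct_sum [OF finV0 finW W(1)] indV gW by blast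
  \<comment> \<open>The base point moves from \<open>s\<close> to its representative
    \<open>t1\<close> in \<open>D\<close>. If \<open>v + t1\<close> is congruent modulo
    \<open>W\<close> to some \<open>t\<close> in \<open>D\<close>, their sum lies in four copies of
    \<open>D\<close>, so they are equal and \<open>g\<close> is \<open>f + 1\<close> there;
    otherwise \<open>g\<close> is 0.\<close>
  also have "\<dots> \<le> avg V0 f t1 + 1"
  proof -
    have "g (v + s) \<le> f (v + t1) + 1" if v: "v \<in> V0" for v
    proof (cases "\<exists>t\<in>D. v + t1 + t \<in> W")
      case True
      then obtain t where t: "t \<in> D" "v + t1 + t \<in> W" by blast
      have "t1 + t \<in> D2" unfolding D2_def using s1 t by (intro set_plus_intro)
      then have "v + (t1 + t) \<in> T" using v D4T by (auto simp: V0_def)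
      then have "(v + t1) + t = 0" using t WT by (simp add: add.assoc)
      then have "v + t1 = t" by (simp only: f2_add_eq_0_iff)
      moreover have "g (v + t1) = f t + 1" using t by (intro g1)
      ultimately have "g (v + t1) \<le> f (v + t1) + 1" by simp
      moreover have "g (v + s) = g (v + t1)"
        using gW [OF s1(3), of "v + t1"] s1(1) by (simp add: add_ac)
      ultimately show ?thesis by simp
    next
      case False
      then have "g (v + t1) = 0" using g0 by blast
      moreover have "g (v + s) = g (v + t1)"
        using gW [OF s1(3), of "v + t1"] s1(1) by (simp add: add_ac)
      ultimately show ?thesis using f [of "v + t1"] by simp
    qed
    then have "(\<Sum>v\<in>V0. g (v + s)) \<le> (\<Sum>v\<in>V0. f (v + t1) + 1)" by (rule sum_mono)
    then have "avg V0 g s \<le> (\<Sum>v\<in>V0. f (v + t1) + 1) / real (card V0)"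
      unfolding avg_def by (rule divide_right_mono) simp
    also have "\<dots> = avg V0 f t1 + 1"
      using finV0 subV0 f2.subspace_0 by (auto simp: avg_def sum.distrib add_divide_distrib)
    finally show ?thesis .
  qed
  finally have "avg V0 f t1 \<ge> avg B (avg A f) 0 - \<delta>" using avgV1 by linarith
  moreover have "V0 \<subseteq> F2 n" using V by (auto simp: V0_def)
  moreover have "t1 \<in> F2 n" using s1 DF by blast
  ultimately show thesis using that subV0 size d by blast
qed

subsection \<open>Minimax\<close>

lemma prob_eq_sum_pmf:
  assumes "finite G" "set_pmf P \<subseteq> G"
  shows "measure_pmf.prob P E = (\<Sum>x\<in>E \<inter> G. pmf P x)"
proof -
  have "measure_pmf.prob P E = measure_pmf.prob P (E \<inter> set_pmf P)"
    by (simp add: measure_Int_set_pmf)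
  also have "\<dots> = measure_pmf.prob P (E \<inter> G \<inter> set_pmf P)"
    using assms(2) by (intro arg_cong [where f = "measure_pmf.prob P"]) auto
  also have "\<dots> = measure_pmf.prob P (E \<inter> G)"
    by (rule measure_Int_set_pmf)
  also have "\<dots> = (\<Sum>x\<in>E \<inter> G. pmf P x)"
    using assms(1) by (intro measure_measure_pmf_finite) auto
  finally show ?thesis .
qed

text \<open>The positive part bounds the difference on every event from one side; the other side is
  the same bound for the complement.\<close>

lemma stat_dist_le:
  assumes G: "finite G" "set_pmf P \<subseteq> G" "set_pmf Q \<subseteq> G"
    and le: "(\<Sum>x\<in>G. max 0 (pmf P x - pmf Q x)) \<le> \<tau>"
  shows "stat_dist P Q \<le> \<tau>"
proof -
  have one: "measure_pmf.prob P E - measure_pmf.prob Q E \<le> \<tau>" for E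
  proof -
    have "measure_pmf.prob P E - measure_pmf.prob Q E = (\<Sum>x\<in>E \<inter> G. pmf P x - pmf Q x)"
      by (simp add: prob_eq_sum_pmf [OF G(1,2)] prob_eq_sum_pmf [OF G(1,3)] sum_subtractf)
    also have "\<dots> \<le> (\<Sum>x\<in>E \<inter> G. max 0 (pmf P x - pmf Q x))"
      by (intro sum_mono) auto
    also have "\<dots> \<le> (\<Sum>x\<in>G. max 0 (pmf P x - pmf Q x))"
      using G by (intro sum_mono2) auto
    finally show ?thesis using le by linarith
  qed
  have compl: "measure_pmf.prob M (- E) = 1 - measure_pmf.prob M E" for M :: "'a pmf" and E
    using measure_pmf.prob_compl [of E M] by (simp add: Compl_eq_Diff_UNIV)
  have "\<bar>measure_pmf.prob P E - measure_pmf.prob Q E\<bar> \<le> \<tau>" for E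
    using one [of E] one [of "- E"] by (simp add: compl)
  then show ?thesis unfolding stat_dist_def by (intro cSUP_least) auto
qed

text \<open>
  Blackwell's approachability argument: against the positive part of the accumulated deficit
  one plays a source that does not lose, so the squared norm of that positive part grows only
  linearly in the number of rounds.
\<close>

lemma convex_combination_close:
  fixes P :: "'a pmf" and \<Phi> :: "'a pmf \<Rightarrow> bool"
  assumes G: "finite G" "set_pmf P \<subseteq> G" and \<Phi>: "\<And>D. \<Phi> D \<Longrightarrow> set_pmf D \<subseteq> G"
    and \<eta>: "\<eta> \<ge> 0" and \<delta>: "\<delta> > 0"
    and test: "\<And>f :: 'a \<Rightarrow> real. (\<And>x. 0 \<le> f x \<and> f x \<le> 1) \<Longrightarrow>
      \<exists>D. \<Phi> D \<and> (\<Sum>x\<in>G. f x * pmf P x) - \<eta> \<le> (\<Sum>x\<in>G. f x * pmf D x)"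
  shows "\<exists>Q. convex_combination_of \<Phi> Q \<and> stat_dist P Q \<le> \<eta> + \<delta>"
proof -
  have G0: "G \<noteq> {}" using G(2) set_pmf_not_empty [of P] by auto
  have cG: "real (card G) > 0" using G(1) G0 by (simp add: card_gt_0_iff)
  \<comment> \<open>The pointwise deficit with the tolerance \<open>\<eta>\<close> charged to a
    single point. Placed where a weight \<open>u\<close> is maximal, the charge amounts to
    \<open>\<eta>\<close> times that maximum, exactly the slack of the test obtained by normalising
    \<open>u\<close>.\<close>
  define c where "c = (\<lambda>D x0 x. pmf P x - pmf D x - (if x = x0 then \<eta> else 0))"
  have step: "\<exists>D x0. \<Phi> D \<and> x0 \<in> G \<and> (\<Sum>x\<in>G. u x * c D x0 x) \<le> 0" if u: "\<And>x. u x \<ge> 0" for u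
  proof -
    define m where "m = Max (u ` G)"
    have "m \<in> u ` G" unfolding m_def using G(1) G0 by (intro Max_in) auto
    then obtain x0 where x0: "x0 \<in> G" "u x0 = m" by blast
    have um: "u x \<le> m" if "x \<in> G" for x unfolding m_def using that G(1) by (intro Max_ge) auto
    have m0: "m \<ge> 0" using u [of x0] x0 by simp
    \<comment> \<open>When \<open>m = 0\<close> the quotient is 0 by convention, so this is an
      admissible test in that case too.\<close>
    define f where "f = (\<lambda>x. if x \<in> G then u x / m else 0)"
    have "0 \<le> f x \<and> f x \<le> 1" for x
      using u um m0 by (auto simp: f_def divide_le_eq_1)
    then obtain D where D: "\<Phi> D" "(\<Sum>x\<in>G. f x * pmf P x) - \<eta> \<le> (\<Sum>x\<in>G. f x * pmf D x)"
      using test by blast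
    have uf: "u x = m * f x" if "x \<in> G" for x
    proof (cases "m = 0")
      case True
      then show ?thesis using um [OF that] u [of x] by simp
    next
      case False
      then show ?thesis using that by (simp add: f_def)
    qed
    have "(\<Sum>x\<in>G. u x * c D x0 x)
        = (\<Sum>x\<in>G. u x * pmf P x) - (\<Sum>x\<in>G. u x * pmf D x) - (\<Sum>x\<in>G. if x = x0 then u x0 * \<eta> else 0)"
      unfolding c_def sum_subtractf [symmetric] by (intro sum.cong) (auto simp: algebra_simps)
    also have "\<dots> = (\<Sum>x\<in>G. u x * pmf P x) - (\<Sum>x\<in>G. u x * pmf D x) - m * \<eta>"
      using G(1) x0 by simp
    also have "(\<Sum>x\<in>G. u x * pmf P x) = m * (\<Sum>x\<in>G. f x * pmf P x)"
      unfolding sum_distrib_left by (intro sum.cong) (auto simp: uf)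
    also have "(\<Sum>x\<in>G. u x * pmf D x) = m * (\<Sum>x\<in>G. f x * pmf D x)"
      unfolding sum_distrib_left by (intro sum.cong) (auto simp: uf)
    also have "m * (\<Sum>x\<in>G. f x * pmf P x) - m * (\<Sum>x\<in>G. f x * pmf D x) - m * \<eta>
        = m * ((\<Sum>x\<in>G. f x * pmf P x) - \<eta> - (\<Sum>x\<in>G. f x * pmf D x))"
      by (simp add: algebra_simps)
    also have "\<dots> \<le> 0" using D m0 by (simp add: mult_nonneg_nonpos)
    finally show ?thesis using D x0 by blast
  qed
  define C where "C = real (card G) * (1 + \<eta>)\<^sup>2"
  have csq: "(\<Sum>x\<in>G. (c D x0 x)\<^sup>2) \<le> C" for D x0
  proof -
    have "(\<Sum>x\<in>G. (c D x0 x)\<^sup>2) \<le> (\<Sum>x\<in>G. (1 + \<eta>)\<^sup>2)"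
    proof (rule sum_mono)
      fix x
      have "0 \<le> (if x = x0 then \<eta> else 0)" "(if x = x0 then \<eta> else 0) \<le> \<eta>" using \<eta> by auto
      then have "\<bar>c D x0 x\<bar> \<le> \<bar>1 + \<eta>\<bar>"
        using pmf_nonneg [of P x] pmf_le_1 [of P x] pmf_nonneg [of D x] pmf_le_1 [of D x] \<eta>
        unfolding c_def by linarith
      then show "(c D x0 x)\<^sup>2 \<le> (1 + \<eta>)\<^sup>2" by (simp only: abs_le_square_iff)
    qed
    then show ?thesis by (simp add: C_def)
  qed
  have play: "\<exists>D x0. (\<forall>t<T. \<Phi> (D t) \<and> x0 t \<in> G) \<and>
      (\<Sum>x\<in>G. (max 0 (\<Sum>t<T. c (D t) (x0 t) x))\<^sup>2) \<le> C * real T" for T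
  proof (induction T)
    case 0
    then show ?case by simp
  next
    case (Suc T)
    then obtain D x0 where D: "\<And>t. t < T \<Longrightarrow> \<Phi> (D t) \<and> x0 t \<in> G"
      and IH: "(\<Sum>x\<in>G. (max 0 (\<Sum>t<T. c (D t) (x0 t) x))\<^sup>2) \<le> C * real T" by blast
    define u where "u = (\<lambda>x. max 0 (\<Sum>t<T. c (D t) (x0 t) x))"
    obtain E y where E: "\<Phi> E" "y \<in> G" "(\<Sum>x\<in>G. u x * c E y x) \<le> 0"
      using step [of u] by (auto simp: u_def)
    define D' where "D' = D(T := E)"
    define x0' where "x0' = x0(T := y)"
    have S: "(\<Sum>t<Suc T. c (D' t) (x0' t) x) = (\<Sum>t<T. c (D t) (x0 t) x) + c E y x" for x
      by (simp add: D'_def x0'_def)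
    have "(\<Sum>x\<in>G. (max 0 (\<Sum>t<Suc T. c (D' t) (x0' t) x))\<^sup>2) \<le> (\<Sum>x\<in>G. (u x + c E y x)\<^sup>2)"
    proof (rule sum_mono)
      fix x
      \<comment> \<open>If the old total is non-negative, the right side is the absolute value of
        the new total; if it is negative, the new positive part is at most that of the
        increment.\<close>
      have "\<bar>max 0 (\<Sum>t<Suc T. c (D' t) (x0' t) x)\<bar> \<le> \<bar>u x + c E y x\<bar>"
        unfolding S u_def by linarith
      then show "(max 0 (\<Sum>t<Suc T. c (D' t) (x0' t) x))\<^sup>2 \<le> (u x + c E y x)\<^sup>2"
        by (simp only: abs_le_square_iff)
    qed
    also have "\<dots> = (\<Sum>x\<in>G. (u x)\<^sup>2) + 2 * (\<Sum>x\<in>G. u x * c E y x) + (\<Sum>x\<in>G. (c E y x)\<^sup>2)"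
      by (simp add: power2_sum sum.distrib sum_distrib_left mult.assoc)
    also have "\<dots> \<le> C * real T + 0 + C"
      using IH E(3) csq [of E y] unfolding u_def by linarith
    also have "\<dots> = C * real (Suc T)" by (simp add: algebra_simps)
    finally have "(\<Sum>x\<in>G. (max 0 (\<Sum>t<Suc T. c (D' t) (x0' t) x))\<^sup>2) \<le> C * real (Suc T)" .
    moreover have "\<forall>t<Suc T. \<Phi> (D' t) \<and> x0' t \<in> G"
      using D E by (auto simp: D'_def x0'_def less_Suc_eq)
    ultimately show ?case by blast
  qed
  \<comment> \<open>Enough rounds for Cauchy-Schwarz to turn the bound \<open>C * T\<close> on
    squares into \<open>\<delta> * T\<close> on the sum of \<open>R\<close>; \<open>Suc\<close>
    keeps \<open>T\<close> positive.\<close>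
  define T where "T = Suc (nat \<lceil>C * real (card G) / \<delta>\<^sup>2\<rceil>)"
  have T0: "real T > 0" by (simp add: T_def)
  have T: "C * real (card G) \<le> \<delta>\<^sup>2 * real T"
  proof -
    have "C * real (card G) / \<delta>\<^sup>2 \<le> real T" unfolding T_def by linarith
    then show ?thesis using \<delta> by (simp add: pos_divide_le_eq mult.commute)
  qed
  obtain D x0 where D: "\<And>t. t < T \<Longrightarrow> \<Phi> (D t) \<and> x0 t \<in> G"
    and bound: "(\<Sum>x\<in>G. (max 0 (\<Sum>t<T. c (D t) (x0 t) x))\<^sup>2) \<le> C * real T"
    using play [of T] by blast
  define R where "R = (\<lambda>x. max 0 (\<Sum>t<T. c (D t) (x0 t) x))"
  define Q where "Q = bind_pmf (pmf_of_set {..<T}) D"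
  have Tne: "{..<T} \<noteq> {}" using T0 by auto
  have pQ: "pmf Q x = (\<Sum>t<T. pmf (D t) x) / real T" for x
    unfolding Q_def using Tne by (simp add: pmf_bind_pmf_of_set)
  have RT: "(\<Sum>x\<in>G. R x) \<le> \<delta> * real T"
  proof -
    have "(\<Sum>x\<in>G. R x)\<^sup>2 \<le> real (card G) * (\<Sum>x\<in>G. (R x)\<^sup>2)"
      using Cauchy_Schwarz_ineq_sum [of "\<lambda>_. 1" R G] by simp
    also have "\<dots> \<le> real (card G) * (C * real T)"
      using bound unfolding R_def by (intro mult_left_mono) auto
    also have "\<dots> = (C * real (card G)) * real T" by simp
    also have "\<dots> \<le> (\<delta>\<^sup>2 * real T) * real T" using T by (intro mult_right_mono) auto
    also have "\<dots> = (\<delta> * real T)\<^sup>2" by (simp add: power2_eq_square)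
    finally show ?thesis by (rule power2_le_imp_le) (use \<delta> in simp)
  qed
  have "(\<Sum>x\<in>G. max 0 (pmf P x - pmf Q x))
      \<le> (\<Sum>x\<in>G. (R x + (\<Sum>t<T. if x = x0 t then \<eta> else 0)) / real T)"
  proof (rule sum_mono)
    fix x
    let ?p = "\<Sum>t<T. if x = x0 t then \<eta> else 0"
    have p0: "?p \<ge> 0" using \<eta> by (intro sum_nonneg) auto
    have "(\<Sum>t<T. c (D t) (x0 t) x) + ?p = real T * pmf P x - (\<Sum>t<T. pmf (D t) x)"
      unfolding c_def by (simp add: sum_subtractf)
    then have "pmf P x - pmf Q x = ((\<Sum>t<T. c (D t) (x0 t) x) + ?p) / real T"
      using T0 by (simp add: pQ field_simps)
    moreover have "((\<Sum>t<T. c (D t) (x0 t) x) + ?p) / real T \<le> (R x + ?p) / real T"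
      using T0 by (intro divide_right_mono) (auto simp: R_def)
    moreover have "0 \<le> (R x + ?p) / real T" using T0 p0 by (intro divide_nonneg_pos) (auto simp: R_def)
    ultimately show "max 0 (pmf P x - pmf Q x) \<le> (R x + ?p) / real T" by simp
  qed
  also have "\<dots> = ((\<Sum>x\<in>G. R x) + (\<Sum>x\<in>G. \<Sum>t<T. if x = x0 t then \<eta> else 0)) / real T"
    by (simp add: sum_divide_distrib [symmetric] sum.distrib)
  also have "(\<Sum>x\<in>G. \<Sum>t<T. if x = x0 t then \<eta> else 0) = (\<Sum>t<T. \<Sum>x\<in>G. if x = x0 t then \<eta> else 0)"
    by (rule sum.swap)
  also have "\<dots> = real T * \<eta>"
    using G(1) D by simp
  also have "((\<Sum>x\<in>G. R x) + real T * \<eta>) / real T \<le> (\<delta> * real T + real T * \<eta>) / real T"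
    using RT T0 by (intro divide_right_mono) auto
  also have "\<dots> = \<eta> + \<delta>" using T0 by (simp add: field_simps)
  finally have "(\<Sum>x\<in>G. max 0 (pmf P x - pmf Q x)) \<le> \<eta> + \<delta>" .
  moreover have "set_pmf Q \<subseteq> G"
    unfolding Q_def using Tne D \<Phi> by (auto simp: set_bind_pmf)
  ultimately have "stat_dist P Q \<le> \<eta> + \<delta>" by (intro stat_dist_le [OF G])
  moreover have "convex_combination_of \<Phi> Q"
    unfolding convex_combination_of_def
  proof (intro exI conjI ballI)
    show "Q = join_pmf (map_pmf D (pmf_of_set {..<T}))" by (simp add: Q_def join_eq_bind_pmf bind_map_pmf)
    fix E assume "E \<in> set_pmf (map_pmf D (pmf_of_set {..<T}))"
    then show "\<Phi> E" using Tne D by auto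
  qed
  ultimately show ?thesis by blast
qed

subsection \<open>Doubling less than 3/2\<close>

text \<open>The translates of \<open>A\<close> by \<open>b\<close> and \<open>b'\<close> both lie in
  \<open>A + B\<close>, which has fewer than 3/2 \<open>card A\<close> elements, so they overlap in
  more than half of \<open>A\<close>.\<close>

lemma small_doubling_popular:
  fixes A B :: "(nat \<Rightarrow> bit) set"
  assumes fin: "finite A" "finite B" and small: "2 * card (A + B) < 3 * card A"
    and b: "b \<in> B" "b' \<in> B"
  shows "card A < 2 * card {a \<in> A. a + (b + b') \<in> A}"
proof -
  let ?P = "(\<lambda>a. a + b) ` A" and ?Q = "(\<lambda>a. a + b') ` A"
  have "card (?P \<union> ?Q) + card (?P \<inter> ?Q) = card ?P + card ?Q"
    using fin by (intro card_Un_Int [symmetric]) auto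
  also have "\<dots> = 2 * card A" by (simp add: card_image)
  finally have 1: "card (?P \<union> ?Q) + card (?P \<inter> ?Q) = 2 * card A" .
  have 2: "card (?P \<union> ?Q) \<le> card (A + B)"
    using fin b by (intro card_mono finite_set_plus) (auto intro: set_plus_intro)
  have "?P \<inter> ?Q \<subseteq> (\<lambda>a. a + b) ` {a \<in> A. a + (b + b') \<in> A}"
  proof
    fix u assume "u \<in> ?P \<inter> ?Q"
    then obtain a a' where a: "a \<in> A" "u = a + b" "a' \<in> A" "u = a' + b'" by auto
    have "a + (b + b') = (a + b) + b'" by (simp add: add.assoc)
    also have "\<dots> = a' + (b' + b')" using a by (metis add.assoc)
    finally have "a + (b + b') \<in> A" using a by simp
    then show "u \<in> (\<lambda>a. a + b) ` {a \<in> A. a + (b + b') \<in> A}" using a by blast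
  qed
  then have "card (?P \<inter> ?Q) \<le> card ((\<lambda>a. a + b) ` {a \<in> A. a + (b + b') \<in> A})"
    using fin by (intro card_mono) auto
  also have "\<dots> = card {a \<in> A. a + (b + b') \<in> A}" by (simp add: card_image)
  finally show ?thesis using 1 2 small by linarith
qed

text \<open>More than half of \<open>A\<close> is carried into \<open>A\<close> by \<open>x\<close>,
  and likewise by \<open>y\<close>; a common \<open>a\<close> gives x + y = (a + x) + (a +
  y).\<close>

lemma small_doubling_closed:
  fixes A B :: "(nat \<Rightarrow> bit) set"
  assumes fin: "finite A" "finite B" and small: "2 * card (A + B) < 3 * card A"
    and x: "x \<in> B + B" and y: "y \<in> B + B"
  shows "x + y \<in> A + A"
proof -
  let ?P = "{a \<in> A. a + x \<in> A}" and ?Q = "{a \<in> A. a + y \<in> A}"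
  obtain b1 b2 where xb: "x = b1 + b2" "b1 \<in> B" "b2 \<in> B" using x by (rule set_plus_elim)
  obtain b3 b4 where yb: "y = b3 + b4" "b3 \<in> B" "b4 \<in> B" using y by (rule set_plus_elim)
  have P: "card A < 2 * card ?P" unfolding xb(1) by (rule small_doubling_popular [OF fin small xb(2,3)])
  have Q: "card A < 2 * card ?Q" unfolding yb(1) by (rule small_doubling_popular [OF fin small yb(2,3)])
  have "?P \<inter> ?Q \<noteq> {}"
  proof
    assume "?P \<inter> ?Q = {}"
    then have "card (?P \<union> ?Q) = card ?P + card ?Q"
      using fin by (intro card_Un_disjoint) auto
    moreover have "card (?P \<union> ?Q) \<le> card A" using fin by (intro card_mono) auto
    ultimately show False using P Q by linarith
  qed
  then obtain a where "a + x \<in> A" "a + y \<in> A" by blast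
  then have "(a + x) + (a + y) \<in> A + A" by (rule set_plus_intro)
  moreover have "(a + x) + (a + y) = x + y" by (simp add: add_ac)
  ultimately show ?thesis by simp
qed

text \<open>Closure with one summand 0, in both roles of \<open>A\<close> and \<open>B\<close>,
  gives \<open>A + A = B + B\<close>, and this set \<open>V\<close> is then a subspace. Each element
  of \<open>V\<close> has more than \<open>card A / 2\<close> representations, so double counting
  gives \<open>card V < 2 * card A\<close>. Both sizes are powers of two and \<open>A\<close> lies
  in a coset of \<open>V\<close>, hence fills it.\<close>

lemma small_doubling_coset:
  assumes A: "A \<subseteq> F2 n" and B: "B \<subseteq> F2 n" and card: "card A = 2 ^ k" "card B = 2 ^ k"
    and small: "2 * card (A + B) < 3 * card A"
  obtains V a where "f2.subspace V" "V \<subseteq> F2 n" "f2.dim V = k" "a \<in> F2 n" "A = (+) a ` V"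
proof -
  have finA: "finite A" using A finite_F2 by (rule finite_subset)
  have finB: "finite B" using B finite_F2 by (rule finite_subset)
  have small': "2 * card (B + A) < 3 * card B" using small card by (simp add: add.commute)
  obtain a0 where a0: "a0 \<in> A" using card(1) by (metis all_not_in_conv card.empty power_not_zero zero_neq_numeral)
  obtain b0 where b0: "b0 \<in> B" using card(2) by (metis all_not_in_conv card.empty power_not_zero zero_neq_numeral)
  have 0: "0 \<in> A + A" "0 \<in> B + B"
    using set_plus_intro [OF a0 a0] set_plus_intro [OF b0 b0] by simp_all
  have AB: "A + A \<subseteq> B + B"
    using small_doubling_closed [OF finB finA small' _ 0(1)] by auto
  have BA: "B + B \<subseteq> A + A"
    using small_doubling_closed [OF finA finB small _ 0(2)] by auto
  define V where "V = A + A"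
  have VB: "V = B + B" using AB BA by (simp add: V_def)
  have sub: "f2.subspace V"
  proof (rule f2_subspaceI)
    show "0 \<in> V" using 0 by (simp add: V_def)
    fix x y assume "x \<in> V" "y \<in> V"
    then show "x + y \<in> V" unfolding V_def
      using small_doubling_closed [OF finA finB small] AB by blast
  qed
  have VF: "V \<subseteq> F2 n" unfolding V_def using A by (auto elim!: set_plus_elim intro!: F2_add)
  have finV: "finite V" using VF finite_F2 by (rule finite_subset)
  have V0: "V \<noteq> {}" using 0 by (auto simp: V_def)
  have AV: "A \<subseteq> (+) a0 ` V"
  proof
    fix a assume "a \<in> A"
    then have "a0 + a \<in> V" unfolding V_def using a0 by (intro set_plus_intro)
    then show "a \<in> (+) a0 ` V" by (metis f2_add_cancel image_eqI)
  qed
  have "card A \<le> card ((+) a0 ` V)" using AV finV by (intro card_mono) auto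
  then have ge: "card A \<le> card V" by (simp add: card_image)
  have lt: "card V < 2 * card A"
  proof -
    have "card V * card A = (\<Sum>x\<in>V. card A)" by simp
    also have "\<dots> < (\<Sum>x\<in>V. 2 * card {a \<in> A. a + x \<in> A})"
    proof (rule sum_strict_mono [OF finV V0])
      fix x assume "x \<in> V"
      then obtain b b' where "x = b + b'" "b \<in> B" "b' \<in> B" unfolding VB by (rule set_plus_elim)
      then show "card A < 2 * card {a \<in> A. a + x \<in> A}"
        using small_doubling_popular [OF finA finB small] by blast
    qed
    also have "\<dots> = 2 * card (SIGMA x:V. {a \<in> A. a + x \<in> A})"
      using finV finA by (simp add: sum_distrib_left [symmetric])
    also have "card (SIGMA x:V. {a \<in> A. a + x \<in> A}) \<le> card (A \<times> A)"
    proof (rule card_inj_on_le)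
      show "inj_on (\<lambda>(x, a). (a, a + x)) (SIGMA x:V. {a \<in> A. a + x \<in> A})"
        by (auto simp: inj_on_def)
      show "(\<lambda>(x, a). (a, a + x)) ` (SIGMA x:V. {a \<in> A. a + x \<in> A}) \<subseteq> A \<times> A" by auto
      show "finite (A \<times> A)" using finA by simp
    qed
    finally have "card V * card A < 2 * card A * card A" by (simp add: card_cartesian_product)
    then show ?thesis by simp
  qed
  have cV: "card V = 2 ^ f2.dim V" by (rule card_subspace_eq_power_dim [OF sub finV])
  have "(2::nat) ^ k \<le> 2 ^ f2.dim V" using ge cV card by simp
  then have "k \<le> f2.dim V" by simp
  moreover have "(2::nat) ^ f2.dim V < 2 ^ Suc k" using lt cV card by simp
  then have "f2.dim V < Suc k" by (simp only: power_strict_increasing_iff)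
  ultimately have dim: "f2.dim V = k" by simp
  have "A = (+) a0 ` V"
    using AV finV dim cV card by (intro card_subset_eq) (auto simp: card_image)
  then show thesis using that sub VF dim a0 A by blast
qed

subsection \<open>Parameters\<close>

lemma sum_pmf_eq_expectation:
  fixes f :: "'a \<Rightarrow> real"
  assumes "finite G" "set_pmf P \<subseteq> G"
  shows "(\<Sum>x\<in>G. f x * pmf P x) = measure_pmf.expectation P f"
  using assms by (intro integral_measure_pmf_real [symmetric]) auto

lemma sum_pmf_coset:
  assumes V: "f2.subspace V" "V \<subseteq> F2 n" and s: "s \<in> F2 n"
  shows "set_pmf (pmf_of_set ((+) s ` V)) \<subseteq> F2 n"
    and "(\<Sum>x\<in>F2 n. f x * pmf (pmf_of_set ((+) s ` V)) x) = avg V f s"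
proof -
  have finV: "finite V" using V(2) finite_F2 by (rule finite_subset)
  have V0: "V \<noteq> {}" using V(1) f2.subspace_0 by blast
  show sub: "set_pmf (pmf_of_set ((+) s ` V)) \<subseteq> F2 n"
    using finV V0 V s by (auto intro!: F2_add)
  have "(\<Sum>x\<in>F2 n. f x * pmf (pmf_of_set ((+) s ` V)) x) = sum f ((+) s ` V) / real (card ((+) s ` V))"
    unfolding sum_pmf_eq_expectation [OF finite_F2 sub] using finV V0 by (intro integral_pmf_of_set) auto
  also have "\<dots> = avg V f s"
    by (simp add: sum.reindex card_image avg_def add.commute)
  finally show "(\<Sum>x\<in>F2 n. f x * pmf (pmf_of_set ((+) s ` V)) x) = avg V f s" .
qed

lemma sum_pmf_sum_distribution:
  assumes A: "A \<subseteq> F2 n" "A \<noteq> {}" and B: "B \<subseteq> F2 n" "B \<noteq> {}"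
  shows "set_pmf (sum_distribution A B) \<subseteq> F2 n"
    and "(\<Sum>x\<in>F2 n. f x * pmf (sum_distribution A B) x) = avg B (avg A f) 0"
proof -
  have finA: "finite A" using A(1) finite_F2 by (rule finite_subset)
  have finB: "finite B" using B(1) finite_F2 by (rule finite_subset)
  show "set_pmf (sum_distribution A B) \<subseteq> F2 n"
    using A B finA finB by (auto simp: sum_distribution_def intro!: F2_add)
  have eq: "sum_distribution A B = bind_pmf (pmf_of_set B) (\<lambda>b. map_pmf (\<lambda>a. a + b) (pmf_of_set A))"
    unfolding sum_distribution_def
    by (subst pair_commute_pmf) (simp add: pair_pmf_def map_pmf_def bind_assoc_pmf bind_return_pmf)
  have "(\<Sum>x\<in>F2 n. f x * pmf (sum_distribution A B) x)
      = (\<Sum>x\<in>F2 n. \<Sum>b\<in>B. f x * pmf (map_pmf (\<lambda>a. a + b) (pmf_of_set A)) x / real (card B))"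
    unfolding eq using finB B(2)
    by (simp add: pmf_bind_pmf_of_set sum_distrib_left sum_divide_distrib)
  also have "\<dots> = (\<Sum>b\<in>B. \<Sum>x\<in>F2 n. f x * pmf (map_pmf (\<lambda>a. a + b) (pmf_of_set A)) x / real (card B))"
    by (rule sum.swap)
  also have "\<dots> = (\<Sum>b\<in>B. avg A f b / real (card B))"
  proof (intro sum.cong refl)
    fix b assume b: "b \<in> B"
    have sub: "set_pmf (map_pmf (\<lambda>a. a + b) (pmf_of_set A)) \<subseteq> F2 n"
      using A B b finA by (auto intro!: F2_add)
    have "(\<Sum>x\<in>F2 n. f x * pmf (map_pmf (\<lambda>a. a + b) (pmf_of_set A)) x) = avg A f b"
      using finA A(2) by (simp add: sum_pmf_eq_expectation [OF finite_F2 sub] integral_pmf_of_set avg_def)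
    then show "(\<Sum>x\<in>F2 n. f x * pmf (map_pmf (\<lambda>a. a + b) (pmf_of_set A)) x / real (card B))
        = avg A f b / real (card B)"
      by (simp add: sum_divide_distrib [symmetric])
  qed
  also have "\<dots> = avg B (avg A f) 0"
    by (simp add: avg_def [of B] sum_divide_distrib)
  finally show "(\<Sum>x\<in>F2 n. f x * pmf (sum_distribution A B) x) = avg B (avg A f) 0" .
qed

lemma sampling_parameters:
  fixes r \<epsilon> :: real
  assumes r: "r \<ge> 3 / 2" and \<epsilon>: "0 < \<epsilon>" "\<epsilon> < 1"
  obtains l q :: nat and e :: real where "0 < e" "e \<le> 1" "q > 0"
    "4 * r ^ 13 * exp (- real q * e\<^sup>2 / 16) \<le> e"
    "4 * r ^ 13 / 2 ^ l + 12 * real l * e \<le> \<epsilon> / 2"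
    "16 * ln (2 * r ^ q * r ^ 13)
      \<le> 10 ^ 11 * (1 / \<epsilon>\<^sup>2) * log 2 r * (log 2 (r / \<epsilon>)) ^ 3"
proof -
  define L where "L = log 2 r"
  define \<Lambda> where "\<Lambda> = log 2 (r / \<epsilon>)"
  \<comment> \<open>The square of 3/2 exceeds 2. This lower bound is what absorbs additive constants
    below.\<close>
  have L: "L \<ge> 1 / 2"
  proof -
    have "1 \<le> log 2 (r ^ 2)"
      using power_mono [OF r, of 2] r by (subst le_log_iff) (auto simp: power2_eq_square)
    then show ?thesis using r by (simp add: L_def log_nat_power)
  qed
  have \<Lambda>eq: "\<Lambda> = L + log 2 (1 / \<epsilon>)"
    using r \<epsilon> by (simp add: \<Lambda>_def L_def log_divide)
  have "log 2 (1 / \<epsilon>) \<ge> 0" using \<epsilon> by simp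
  then have \<Lambda>L: "\<Lambda> \<ge> L" using \<Lambda>eq by simp
  then have \<Lambda>: "\<Lambda> \<ge> 1 / 2" using L by simp
  have re: "2 powr \<Lambda> = r / \<epsilon>" using r \<epsilon> by (simp add: \<Lambda>_def)
  have re1: "r / \<epsilon> \<ge> 1" using r \<epsilon> by (simp add: le_divide_eq)
  have r13: "r ^ 13 / \<epsilon> \<le> 2 powr (13 * \<Lambda>)"
  proof -
    have "\<epsilon> ^ 13 \<le> \<epsilon> ^ 1" using \<epsilon> by (intro power_decreasing) auto
    then have "r ^ 13 / \<epsilon> \<le> r ^ 13 / \<epsilon> ^ 13"
      using r \<epsilon> by (intro divide_left_mono) auto
    also have "\<dots> = (2 powr \<Lambda>) ^ 13" by (simp add: re power_divide)
    also have "\<dots> = 2 powr (13 * \<Lambda>)" by (simp add: powr_power mult.commute)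
    finally show ?thesis .
  qed
  \<comment> \<open>Chosen to make \<open>2 ^ l\<close> at least
    \<open>16 * r ^ 13 / \<epsilon>\<close>, so that the Fourier tail is at most
    \<open>\<epsilon> / 4\<close>.\<close>
  define l where "l = nat \<lceil>4 + 13 * \<Lambda>\<rceil>"
  have l1: "4 + 13 * \<Lambda> \<le> real l" unfolding l_def by linarith
  have l2: "real l \<le> 5 + 13 * \<Lambda>" unfolding l_def using \<Lambda> by linarith
  have l3: "real l \<le> 23 * \<Lambda>" using l2 \<Lambda> by linarith
  have l0: "real l \<ge> 1" using l1 \<Lambda> by linarith
  \<comment> \<open>Makes the accumulated sampling error \<open>12 * l * e\<close> equal to
    \<open>\<epsilon> / 4\<close>.\<close>
  define e where "e = \<epsilon> / (48 * real l)"
  have e0: "e > 0" using \<epsilon> l0 by (simp add: e_def)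
  have e1: "e \<le> 1" using \<epsilon> l0 by (simp add: e_def divide_le_eq)
  have half: "4 * r ^ 13 / 2 ^ l + 12 * real l * e \<le> \<epsilon> / 2"
  proof -
    have "16 * (r ^ 13 / \<epsilon>) \<le> 2 powr 4 * 2 powr (13 * \<Lambda>)"
      using r13 by simp
    also have "\<dots> = 2 powr (4 + 13 * \<Lambda>)" by (simp only: powr_add)
    also have "\<dots> \<le> 2 powr (real l)" using l1 by (intro powr_mono) auto
    also have "\<dots> = 2 ^ l" by (simp add: powr_realpow)
    finally have "4 * r ^ 13 / 2 ^ l \<le> \<epsilon> / 4" using \<epsilon> by (simp add: field_simps)
    moreover have "12 * real l * e = \<epsilon> / 4" using l0 by (simp add: e_def)
    ultimately show ?thesis by simp
  qed
  define M where "M = ln (4 * r ^ 13 / e)"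
  have pos: "4 * r ^ 13 / e > 0" using r e0 by (intro divide_pos_pos) auto
  have "4 * r ^ 13 / e = 192 * real l * (r ^ 13 / \<epsilon>)"
    using l0 by (simp add: e_def)
  also have "\<dots> \<le> (2 powr 8 * 2 powr real l) * 2 powr (13 * \<Lambda>)"
  proof (intro mult_mono r13)
    have "real l \<le> 2 ^ l" using of_nat_less_two_power [of l] by (simp add: less_imp_le)
    then show "real l \<le> 2 powr real l" by (simp add: powr_realpow)
  qed (use r \<epsilon> in auto)
  also have "\<dots> = 2 powr (8 + real l + 13 * \<Lambda>)" by (simp only: powr_add)
  finally have "M \<le> ln (2 powr (8 + real l + 13 * \<Lambda>))"
    unfolding M_def using pos by (intro iffD2 [OF ln_le_cancel_iff]) auto
  also have "\<dots> = (8 + real l + 13 * \<Lambda>) * ln 2" by (simp add: ln_powr)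
  also have "\<dots> \<le> (8 + real l + 13 * \<Lambda>) * 1"
    using \<Lambda> ln_2_less_1 by (intro mult_left_mono) auto
  \<comment> \<open>52 = 16 + 23 + 13, as 8 is at most \<open>16 * \<Lambda>\<close>.\<close>
  also have "\<dots> \<le> 52 * \<Lambda>" using l3 \<Lambda> by simp
  finally have M: "M \<le> 52 * \<Lambda>" .
  \<comment> \<open>The sampling condition amounts to \<open>q * e\<^sup>2 / 16 \<ge> M\<close>;
    \<open>Suc\<close> also gives \<open>q > 0\<close>.\<close>
  define q where "q = Suc (nat \<lceil>16 * M / e\<^sup>2\<rceil>)"
  have q1: "16 * M / e\<^sup>2 \<le> real q" unfolding q_def by linarith
  have samples: "4 * r ^ 13 * exp (- real q * e\<^sup>2 / 16) \<le> e"
  proof -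
    have "M \<le> real q * e\<^sup>2 / 16" using q1 e0 by (simp add: pos_divide_le_eq)
    then have "exp (- (real q * e\<^sup>2 / 16)) \<le> exp (- M)" by simp
    also have "\<dots> = e / (4 * r ^ 13)"
      unfolding M_def exp_minus using pos by simp
    finally have "exp (- real q * e\<^sup>2 / 16) \<le> e / (4 * r ^ 13)" by simp
    then show ?thesis using r by (simp add: pos_le_divide_eq mult.commute)
  qed
  define U where "U = \<Lambda> ^ 3 / \<epsilon>\<^sup>2"
  have U: "U \<ge> 1 / 8"
  proof -
    have "1 / 8 \<le> \<Lambda> ^ 3" using power_mono [OF \<Lambda>, of 3] by (simp add: power_divide)
    also have "\<dots> \<le> U"
    proof -
      have "\<epsilon>\<^sup>2 \<le> 1" using \<epsilon> by (simp add: power_le_one)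
      then show ?thesis
        unfolding U_def using \<Lambda> \<epsilon> by (simp add: le_divide_eq mult_left_le)
    qed
    finally show ?thesis .
  qed
  \<comment> \<open>832 = 16 * 52 and 1104 = 48 * 23; the added 2 pays for rounding up and for
    \<open>Suc\<close>.\<close>
  have "real q \<le> 832 * 1104\<^sup>2 * U + 2"
  proof -
    have "16 * M / e\<^sup>2 \<le> 16 * (52 * \<Lambda>) / e\<^sup>2"
      using M by (intro divide_right_mono) auto
    also have "\<dots> = 832 * \<Lambda> * (48 * real l)\<^sup>2 / \<epsilon>\<^sup>2"
      by (simp add: e_def power_divide)
    also have "\<dots> \<le> 832 * \<Lambda> * (48 * (23 * \<Lambda>))\<^sup>2 / \<epsilon>\<^sup>2"
      using l3 \<Lambda> by (intro divide_right_mono mult_left_mono power_mono) auto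
    also have "\<dots> = 832 * 1104\<^sup>2 * U"
      by (simp add: U_def power2_eq_square power3_eq_cube)
    finally have "16 * M / e\<^sup>2 \<le> 832 * 1104\<^sup>2 * U" .
    moreover have "0 \<le> 832 * 1104\<^sup>2 * U" using U by simp
    ultimately show ?thesis unfolding q_def by linarith
  qed
  \<comment> \<open>16 * 832 * 1104^2 is below 1.7 * 10^10, and the additive 17 is at most
    \<open>136 * U\<close>; the power of ten is a round number above the total.\<close>
  then have qU: "16 * (real q + 15) \<le> 10 ^ 11 * U" using U by simp
  have "16 * ln (2 * r ^ q * r ^ 13) = 16 * (ln 2 + (real q + 13) * ln r)"
    using r by (simp add: ln_mult ln_realpow algebra_simps)
  also have "\<dots> \<le> 16 * (2 * L + (real q + 13) * L)"
  proof -
    have "ln r = L * ln 2" using r by (simp add: L_def log_def)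
    also have "\<dots> \<le> L * 1" using L ln_2_less_1 by (intro mult_left_mono) auto
    finally have "(real q + 13) * ln r \<le> (real q + 13) * L" by (intro mult_left_mono) auto
    moreover have "ln 2 \<le> 2 * L" using L ln_2_less_1 by linarith
    ultimately show ?thesis by (intro mult_left_mono add_mono) auto
  qed
  also have "\<dots> = 16 * (real q + 15) * L" by (simp add: algebra_simps)
  also have "\<dots> \<le> 10 ^ 11 * U * L" using qU L by (intro mult_right_mono) auto
  also have "\<dots> = 10 ^ 11 * (1 / \<epsilon>\<^sup>2) * L * \<Lambda> ^ 3" by (simp add: U_def)
  finally have "16 * ln (2 * r ^ q * r ^ 13)
      \<le> 10 ^ 11 * (1 / \<epsilon>\<^sup>2) * log 2 r * (log 2 (r / \<epsilon>)) ^ 3"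
    by (simp only: L_def \<Lambda>_def)
  moreover have "q > 0" by (simp add: q_def)
  ultimately show thesis using that e0 e1 samples half by blast
qed

section \<open>One good affine source for each test function\<close>

lemma sumset_source_for_test:
  assumes r: "r \<ge> 1" and \<epsilon>: "0 < \<epsilon>" "\<epsilon> < 1" and A: "A \<subseteq> F2 n" and B: "B \<subseteq> F2 n"
    and card: "card A = 2 ^ k" "card B = 2 ^ k"
    and AB: "real (card (A + B)) \<le> r * real (card A)"
    and f: "\<And>x. 0 \<le> f x \<and> f x \<le> 1"
  obtains V s where "f2.subspace V" "V \<subseteq> F2 n" "s \<in> F2 n"
    "real (f2.dim V) \<ge> real k - 10 ^ 11 * (1 / \<epsilon>\<^sup>2) * log 2 r * (log 2 (r / \<epsilon>)) ^ 3"
    "avg V f s \<ge> avg B (avg A f) 0 - \<epsilon> / 2"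
proof -
  let ?loss = "10 ^ 11 * (1 / \<epsilon>\<^sup>2) * log 2 r * (log 2 (r / \<epsilon>)) ^ 3"
  have finA: "finite A" using A finite_F2 by (rule finite_subset)
  have finB: "finite B" using B finite_F2 by (rule finite_subset)
  have A0: "A \<noteq> {}" and B0: "B \<noteq> {}" using card by auto
  have loss0: "?loss \<ge> 0" using r \<epsilon> by (intro mult_nonneg_nonneg zero_le_power) auto
  \<comment> \<open>A small mean is split off because the lifting requires a mean above its error;
    there the whole space serves, as its mean is non-negative and its dimension at least
    \<open>k\<close>.\<close>
  consider (coset) "r < 3 / 2" | (trivial) "avg B (avg A f) 0 \<le> \<epsilon> / 2"
    | (main) "r \<ge> 3 / 2" "\<epsilon> / 2 < avg B (avg A f) 0" by linarith
  then show thesis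
  proof cases
    case coset
    have "real (card (A + B)) < 3 / 2 * real (card A)"
    proof -
      have "r * real (card A) < 3 / 2 * real (card A)"
        using coset card by (intro mult_strict_right_mono) auto
      then show ?thesis using AB by linarith
    qed
    then have "2 * card (A + B) < 3 * card A" by linarith
    then obtain V a where V: "f2.subspace V" "V \<subseteq> F2 n" "f2.dim V = k" "a \<in> F2 n" "A = (+) a ` V"
      by (rule small_doubling_coset [OF A B card])
    obtain b where b: "b \<in> B" "avg B (avg A f) 0 \<le> avg A f (b + 0)"
      by (rule avg_le_some [OF finB B0])
    have "avg A f (b + 0) = avg V f (a + b)"
      by (simp add: avg_def V(5) sum.reindex card_image add_ac)
    then show thesis
      using that [of V "a + b"] V b B loss0 \<epsilon> by (auto intro!: F2_add)
  next
    case trivial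
    have "card (F2 n) = 2 ^ f2.dim (F2 n)"
      by (intro card_subspace_eq_power_dim subspace_F2) simp
    moreover have "card A \<le> card (F2 n)" using A by (intro card_mono) auto
    ultimately have "(2::nat) ^ k \<le> 2 ^ f2.dim (F2 n)" using card by simp
    then have "k \<le> f2.dim (F2 n)" by simp
    moreover have "avg (F2 n) f 0 \<ge> 0"
      unfolding avg_def using f by (intro divide_nonneg_nonneg sum_nonneg) auto
    ultimately show thesis
      using that [of "F2 n" 0] subspace_F2 trivial loss0 by simp
  next
    case main
    obtain l q e where e: "0 < e" "e \<le> 1" and q: "q > 0"
      and samples: "4 * r ^ 13 * exp (- real q * e\<^sup>2 / 16) \<le> e"
      and half: "4 * r ^ 13 / 2 ^ l + 12 * real l * e \<le> \<epsilon> / 2"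
      and loss: "16 * ln (2 * r ^ q * r ^ 13) \<le> ?loss"
      by (rule sampling_parameters [OF main(1) \<epsilon>])
    have cAB: "card A = card B" using card by simp
    have large: "4 * r ^ 13 / 2 ^ l + 12 * real l * e < avg B (avg A f) 0"
      using half main(2) by linarith
    obtain V d s where V: "f2.subspace V" "V \<subseteq> F2 n" "card A \<le> card V * 2 ^ d"
      and d: "real d \<le> 16 * ln (2 * r ^ q * r ^ 13)" and s: "s \<in> F2 n"
      and avgV: "avg V f s \<ge> avg B (avg A f) 0 - (4 * r ^ 13 / 2 ^ l + 12 * real l * e)"
      by (rule sumset_coset [OF A A0 B cAB f AB r e q samples refl large])
    have "finite V" using V(2) finite_F2 by (rule finite_subset)
    then have "card V = 2 ^ f2.dim V" by (rule card_subspace_eq_power_dim [OF V(1)])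
    then have "(2::nat) ^ k \<le> 2 ^ (f2.dim V + d)" using V(3) card by (simp add: power_add)
    then have "k \<le> f2.dim V + d" by simp
    then have "real (f2.dim V) \<ge> real k - ?loss" using d loss by linarith
    moreover have "avg V f s \<ge> avg B (avg A f) 0 - \<epsilon> / 2" using avgV half by linarith
    ultimately show thesis using that V s by blast
  qed
qed

theorem theorem6:
  "\<exists>c::real. c > 0 \<and>
    (\<forall>(n::nat) (k::nat) (r::real) (\<epsilon>::real) (A::(nat \<Rightarrow> bit) set) (B::(nat \<Rightarrow> bit) set).
      r \<ge> 1 \<longrightarrow> 0 < \<epsilon> \<longrightarrow> \<epsilon> < 1 \<longrightarrow> A \<subseteq> F2 n \<longrightarrow> B \<subseteq> F2 n \<longrightarrow>
      card A = 2 ^ k \<longrightarrow> card B = 2 ^ k \<longrightarrow>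
      real (card {a + b | a b. a \<in> A \<and> b \<in> B}) \<le> r * real (card A) \<longrightarrow>
      (\<exists>Q. convex_combination_of
             (\<lambda>D. \<exists>d. affine_source n d D \<and>
                real d \<ge> real k - c * (1 / \<epsilon>\<^sup>2) * log 2 r * (log 2 (r / \<epsilon>)) ^ 3) Q \<and>
           stat_dist (sum_distribution A B) Q \<le> \<epsilon>))"
proof (intro exI [of _ "10 ^ 11"] conjI allI impI)
  show "(10 ^ 11 :: real) > 0" by simp
next
  fix n k :: nat and r \<epsilon> :: real and A B :: "(nat \<Rightarrow> bit) set"
  assume r: "r \<ge> 1" and \<epsilon>: "0 < \<epsilon>" "\<epsilon> < 1" and A: "A \<subseteq> F2 n" and B: "B \<subseteq> F2 n"
    and card: "card A = 2 ^ k" "card B = 2 ^ k"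
    and "real (card {a + b | a b. a \<in> A \<and> b \<in> B}) \<le> r * real (card A)"
  moreover have "{a + b | a b. a \<in> A \<and> b \<in> B} = A + B" by (auto simp: set_plus_def)
  ultimately have AB: "real (card (A + B)) \<le> r * real (card A)" by simp
  let ?\<Phi> = "\<lambda>D. \<exists>d. affine_source n d D \<and>
    real d \<ge> real k - 10 ^ 11 * (1 / \<epsilon>\<^sup>2) * log 2 r * (log 2 (r / \<epsilon>)) ^ 3"
  have ne: "A \<noteq> {}" "B \<noteq> {}" using card by auto
  note P = sum_pmf_sum_distribution [OF A ne(1) B ne(2)]
  \<comment> \<open>One half of the error is the loss against a single test, the other half comes
    from stopping the minimax play after finitely many rounds.\<close>
  have "\<exists>Q. convex_combination_of ?\<Phi> Q \<and> stat_dist (sum_distribution A B) Q \<le> \<epsilon> / 2 + \<epsilon> / 2"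
  proof (rule convex_combination_close [OF finite_F2 P(1)])
    show "set_pmf D \<subseteq> F2 n" if "?\<Phi> D" for D
      using that sum_pmf_coset(1) by (auto simp: affine_source_def affine_subspace_def)
    fix f :: "(nat \<Rightarrow> bit) \<Rightarrow> real" assume f: "\<And>x. 0 \<le> f x \<and> f x \<le> 1"
    obtain V s where V: "f2.subspace V" "V \<subseteq> F2 n" "s \<in> F2 n"
      and dim: "real (f2.dim V) \<ge> real k - 10 ^ 11 * (1 / \<epsilon>\<^sup>2) * log 2 r * (log 2 (r / \<epsilon>)) ^ 3"
      and avgV: "avg V f s \<ge> avg B (avg A f) 0 - \<epsilon> / 2"
      by (rule sumset_source_for_test [OF r \<epsilon> A B card AB f])
    have "affine_source n (f2.dim V) (pmf_of_set ((+) s ` V))"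
      using V unfolding affine_source_def affine_subspace_def by blast
    then have "?\<Phi> (pmf_of_set ((+) s ` V))" using dim by blast
    moreover have "(\<Sum>x\<in>F2 n. f x * pmf (sum_distribution A B) x) - \<epsilon> / 2
        \<le> (\<Sum>x\<in>F2 n. f x * pmf (pmf_of_set ((+) s ` V)) x)"
      unfolding P(2) sum_pmf_coset(2) [OF V] by (rule avgV)
    ultimately show "\<exists>D. ?\<Phi> D \<and> (\<Sum>x\<in>F2 n. f x * pmf (sum_distribution A B) x) - \<epsilon> / 2
        \<le> (\<Sum>x\<in>F2 n. f x * pmf D x)" by blast
  qed (use \<epsilon> in auto)
  then show "\<exists>Q. convex_combination_of ?\<Phi> Q \<and> stat_dist (sum_distribution A B) Q \<le> \<epsilon>"
    by simp
qed

end
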